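(* For combinatorial parameters $Y,Z$ (maps assigning a non-negative number to each finite concept class), write $Y\to Z$ if (1) $Y(C)\le Z(C)$ for every concept class $C$, and (2) there exists a concept class $C$ with $Y(C)<Z(C)$. Then all of the following relations hold: $$\mathrm{SMN}'\to\mathrm{SMN},\quad \mathrm{SMN}\to\mathrm{GMN},\quad \mathrm{GMN}\to\mathrm{GMN}',\quad \mathrm{GMN}'\to\min\{\mathrm{VCD},\mathrm{RTD}\},$$ $$\mathrm{SMN}'\to\mathrm{AMN}',\quad \mathrm{AMN}'\to\mathrm{AMN},\quad \mathrm{AMN}\to\mathrm{STD}_{min},\quad \mathrm{STD}_{min}\to\min\{\mathrm{VCD},\mathrm{RTD}\},$$ $$\mathrm{SMN}\to\mathrm{AMN},\quad \mathrm{AMN}'\to\mathrm{GMN}'.$$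
   Context: Let $X$ be a finite set. A concept class $C$ over the domain $X=\mathrm{dom}(C)$ is a nonempty family of functions $c:X\to\{0,1\}$ (called concepts). A labeled sample of size $m\ge 0$ is a set $S=\{(x_1,b_1),\ldots,(x_m,b_m)\}\subseteq X\times\{0,1\}$ with $x_1,\ldots,x_m$ distinct; $|S|=m$ (the empty sample is allowed). A concept $c$ is consistent with $S$ if $c(x_i)=b_i$ for all $i$. $S$ is $C$-realizable if some $c\in C$ is consistent with $S$. A $C$-saturating matching is a map $M$ assigning to each $c\in C$ a labeled sample $M(c)$ with which $c$ is consistent, such that $M(c)\ne M(c')$ whenever $c\neq c'$ in $C$. Its cost is $\max_{c\in C}|M(c)|$. It has the antichain property if $M(c)\not\subseteq M(c')$ for all distinct $c,c'\in C$. A $C$-saturating matching $M'$ is a direct improvement of a $C$-saturating matching $M$ if $M'$ differs from $M$ only on a single concept $c$ and $|M'(c)|<|M(c)|$. $M$ is greedy if it admits no direct improvement. Parameters: - $\mathrm{SMN}(C)$: the smallest cost of a $C$-saturating matching. - $\mathrm{SMN}'(C)$: the smallest $d$ such that the number of $C$-realizable samples of size at most $d$ is at least $|C|$. - $\mathrm{AMN}(C)$: the smallest cost of a $C$-saturating matching having the antichain property. - $\mathrm{AMN}'(C)$: the smallest $d$ such that the set of $C$-realizable samples of size at most $d$ contains an antichain (with respect to inclusion) of size $|C|$. - $\mathrm{GMN}(C)$: the largest cost of a greedy $C$-saturating matching. - $\mathrm{GMN}'(C)$: the smallest $d$ such that $\sum_{i=0}^{d}\binom{|X|}{i}\ge|C|$.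 - $\mathrm{VCD}(C)$: the VC-dimension, i.e. the size of the largest set $\{x_1,\ldots,x_r\}\subseteq X$ such that for every choice of $b_1,\ldots,b_r\in\{0,1\}$ the sample $\{(x_1,b_1),\ldots,(x_r,b_r)\}$ is $C$-realizable. - $\mathrm{RTD}(C)$: the recursive teaching dimension, $\mathrm{RTD}(C)=\max_{\emptyset\ne C'\subseteq C}\min_{c\in C'}\mathrm{TD}(c,C')$, where $\mathrm{TD}(c,C')$ is the smallest size of a labeled sample $S$ such that $c$ is the only concept in $C'$ consistent with $S$. - $\mathrm{STD}_{min}(C)$: a sequence $\mathcal{M}=(M_k)_{k\ge 0}$ of $C$-saturating matchings is a subset teaching sequence for $C$ if $M_0(c)=\{(x,c(x)):x\in X\}$ for all $c\in C$; $M_{k+1}(c)\subseteq M_k(c)$ for all $k\ge0$, $c\in C$; and $M_{k+1}(c)\not\subseteq M_k(c')$ for all $k\ge 0$ and all distinct $c,c'\in C$. Let $k^*(\mathcal{M})=\min\{k:\forall k'\ge k,\ \forall c\in C,\ M_{k'}(c)=M_k(c)\}$ and let $\mathrm{cost}(\mathcal{M})$ be the cost of $M_{k^*(\mathcal{M})}$. Then $\mathrm{STD}_{min}(C)$ is the minimum of $\mathrm{cost}(\mathcal{M})$ over all subset teaching sequences $\mathcal{M}$ for $C$. $\min\{\mathrm{VCD},\mathrm{RTD}\}$ denotes the parameter $C\mapsto\min\{\mathrm{VCD}(C),\mathrm{RTD}(C)\}$. *)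

theory Defs
  imports Main "HOL-Library.FuncSet" "HOL-Library.Infinite_Typeclass"
begin

type_synonym 'a concept = "'a \<Rightarrow> bool"
type_synonym 'a sample = "('a \<times> bool) set"

text \<open>
  Labels 1 and 0 are \<^const>\<open>True\<close> and \<^const>\<open>False\<close>. A function on the domain \<open>X\<close> is
  represented extensionally (by \<^const>\<open>PiE\<close>), so that two concepts are equal iff they agree
  on \<open>X\<close>. The domain is not determined by \<open>C\<close> and is therefore passed explicitly.
\<close>

definition concept_class :: "'a set \<Rightarrow> 'a concept set \<Rightarrow> bool" where
  "concept_class X C \<longleftrightarrow> finite X \<and> C \<noteq> {} \<and> C \<subseteq> (X \<rightarrow>\<^sub>E UNIV)"

definition labeled_sample :: "'a set \<Rightarrow> 'a sample \<Rightarrow> bool" where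
  "labeled_sample X S \<longleftrightarrow> finite S \<and> S \<subseteq> X \<times> UNIV \<and> inj_on fst S"

definition consistent :: "'a concept \<Rightarrow> 'a sample \<Rightarrow> bool" where
  "consistent c S \<longleftrightarrow> (\<forall>(x, b) \<in> S. c x = b)"

definition realizable :: "'a concept set \<Rightarrow> 'a sample \<Rightarrow> bool" where
  "realizable C S \<longleftrightarrow> (\<exists>c\<in>C. consistent c S)"

definition realizable_samples :: "'a set \<Rightarrow> 'a concept set \<Rightarrow> nat \<Rightarrow> 'a sample set" where
  "realizable_samples X C d = {S. labeled_sample X S \<and> realizable C S \<and> card S \<le> d}"

text \<open>
  Matchings are total functions in HOL; every notion below depends only on their values on \<open>C\<close>.
\<close>

definition saturating_matching ::
  "'a set \<Rightarrow> 'a concept set \<Rightarrow> ('a concept \<Rightarrow> 'a sample) \<Rightarrow> bool" where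
  "saturating_matching X C M \<longleftrightarrow>
     (\<forall>c\<in>C. labeled_sample X (M c) \<and> consistent c (M c)) \<and> inj_on M C"

definition cost :: "'a concept set \<Rightarrow> ('a concept \<Rightarrow> 'a sample) \<Rightarrow> nat" where
  "cost C M = Max ((\<lambda>c. card (M c)) ` C)"

definition antichain_property :: "'a concept set \<Rightarrow> ('a concept \<Rightarrow> 'a sample) \<Rightarrow> bool" where
  "antichain_property C M \<longleftrightarrow> (\<forall>c\<in>C. \<forall>c'\<in>C. c \<noteq> c' \<longrightarrow> \<not> M c \<subseteq> M c')"

definition direct_improvement ::
  "'a set \<Rightarrow> 'a concept set \<Rightarrow> ('a concept \<Rightarrow> 'a sample) \<Rightarrow> ('a concept \<Rightarrow> 'a sample) \<Rightarrow> bool" where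
  "direct_improvement X C M' M \<longleftrightarrow>
     saturating_matching X C M' \<and> saturating_matching X C M \<and>
     (\<exists>c\<in>C. (\<forall>c'\<in>C. c' \<noteq> c \<longrightarrow> M' c' = M c') \<and> card (M' c) < card (M c))"

definition greedy_matching ::
  "'a set \<Rightarrow> 'a concept set \<Rightarrow> ('a concept \<Rightarrow> 'a sample) \<Rightarrow> bool" where
  "greedy_matching X C M \<longleftrightarrow>
     saturating_matching X C M \<and> (\<nexists>M'. direct_improvement X C M' M)"

text \<open>
  All parameters are curried in the domain and the class. Each is used only for
  \<^term>\<open>concept_class X C\<close>; there every minimum and maximum is attained.
\<close>

type_synonym 'a parameter = "'a set \<Rightarrow> 'a concept set \<Rightarrow> nat"

definition SMN :: "'a parameter" where
  "SMN X C = (LEAST d. \<exists>M. saturating_matching X C M \<and> cost C M = d)"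

definition SMN' :: "'a parameter" where
  "SMN' X C = (LEAST d. card C \<le> card (realizable_samples X C d))"

definition AMN :: "'a parameter" where
  "AMN X C =
     (LEAST d. \<exists>M. saturating_matching X C M \<and> antichain_property C M \<and> cost C M = d)"

definition AMN' :: "'a parameter" where
  "AMN' X C =
     (LEAST d. \<exists>A \<subseteq> realizable_samples X C d.
        pairwise (\<lambda>S T. \<not> S \<subseteq> T) A \<and> card A = card C)"

definition GMN :: "'a parameter" where
  "GMN X C = Max {cost C M | M. greedy_matching X C M}"

definition GMN' :: "'a parameter" where
  "GMN' X C = (LEAST d. card C \<le> (\<Sum>i\<le>d. card X choose i))"

definition shattered :: "'a concept set \<Rightarrow> 'a set \<Rightarrow> bool" where
  "shattered C A \<longleftrightarrow> (\<forall>b :: 'a \<Rightarrow> bool. realizable C ((\<lambda>x. (x, b x)) ` A))"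

definition VCD :: "'a parameter" where
  "VCD X C = Max {card A | A. A \<subseteq> X \<and> shattered C A}"

definition TD :: "'a set \<Rightarrow> 'a concept \<Rightarrow> 'a concept set \<Rightarrow> nat" where
  "TD X c C' =
     (LEAST d. \<exists>S. labeled_sample X S \<and> {c' \<in> C'. consistent c' S} = {c} \<and> card S = d)"

definition RTD :: "'a parameter" where
  "RTD X C = Max {Min ((\<lambda>c. TD X c C') ` C') | C'. C' \<noteq> {} \<and> C' \<subseteq> C}"

definition subset_teaching_sequence ::
  "'a set \<Rightarrow> 'a concept set \<Rightarrow> (nat \<Rightarrow> 'a concept \<Rightarrow> 'a sample) \<Rightarrow> bool" where
  "subset_teaching_sequence X C \<M> \<longleftrightarrow>
     (\<forall>k. saturating_matching X C (\<M> k)) \<and>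
     (\<forall>c\<in>C. \<M> 0 c = (\<lambda>x. (x, c x)) ` X) \<and>
     (\<forall>k. \<forall>c\<in>C. \<M> (Suc k) c \<subseteq> \<M> k c) \<and>
     (\<forall>k. \<forall>c\<in>C. \<forall>c'\<in>C. c \<noteq> c' \<longrightarrow> \<not> \<M> (Suc k) c \<subseteq> \<M> k c')"

definition stabilization_index ::
  "'a concept set \<Rightarrow> (nat \<Rightarrow> 'a concept \<Rightarrow> 'a sample) \<Rightarrow> nat" where
  "stabilization_index C \<M> = (LEAST k. \<forall>k'\<ge>k. \<forall>c\<in>C. \<M> k' c = \<M> k c)"

definition sequence_cost ::
  "'a concept set \<Rightarrow> (nat \<Rightarrow> 'a concept \<Rightarrow> 'a sample) \<Rightarrow> nat" where
  "sequence_cost C \<M> = cost C (\<M> (stabilization_index C \<M>))"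

definition STD_min :: "'a parameter" where
  "STD_min X C = (LEAST d. \<exists>\<M>. subset_teaching_sequence X C \<M> \<and> sequence_cost C \<M> = d)"

definition min_VCD_RTD :: "'a parameter" where
  "min_VCD_RTD X C = min (VCD X C) (RTD X C)"

text \<open>
  Domains are the finite subsets of a fixed infinite universe, so that they have every finite
  cardinality; over a finite type the existential part could fail for lack of points.
\<close>

definition parameter_arrow ::
  "('a :: infinite) parameter \<Rightarrow> 'a parameter \<Rightarrow> bool" (infix "\<longmapsto>" 50) where
  "Y \<longmapsto> Z \<longleftrightarrow>
     (\<forall>X C. concept_class X C \<longrightarrow> Y X C \<le> Z X C) \<and>
     (\<exists>X C. concept_class X C \<and> Y X C < Z X C)"

end

theory Submission
  imports Defs
begin

text \<open>
  \<open>GMN'\<close> is bounded by \<open>VCD\<close> through Sauer's lemma, and by \<open>RTD = d\<close> because the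
  polynomials over GF(2) of degree at most \<open>d\<close> represent every function on the class.
  \<open>STD_min\<close> is bounded by \<open>VCD\<close> by running once through the domain, every concept dropping a
  point whenever that is permitted (the points that are kept form shattered sets), and by \<open>RTD\<close> by
  shrinking the samples of one concept after another along a teaching order. For \<open>AMN' \<le> GMN'\<close>,
  samples of equal size form an antichain, and a class of at most \<open>\<Sum>i\<le>d. n choose i\<close> concepts has
  at least as many realizable samples of size exactly \<open>d\<close> as concepts.

  Each inequality is strict on some small class: cubes, possibly with constant points added, a cube
  together with one antipodal concept, and two complementary copies of a square.
\<close>

section \<open>Samples as restrictions of concepts\<close>

text \<open>\<open>GMN'\<close> depends only on \<open>card C\<close> and \<open>card X\<close>, so
  every comparison with it is a count against one binomial sum, which measures sets, monomials and
  restrictions of a concept alike. The number of samples of size exactly \<open>d\<close>, by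
  contrast, depends on the class; its lower bound is stated as a minimum of \<open>card C\<close>
  and the binomial sum so that it can be applied to slices of any size. All strictness claims lie
  between the values 1 and 2, where only the empty sample and singletons have to be counted. Five
  classes suffice for ten relations, since a gap between two parameters passes along the
  inequalities to parameters below the smaller and above the larger one.\<close>

definition sample_of :: "'a concept \<Rightarrow> 'a set \<Rightarrow> 'a sample" where
  "sample_of c A = (\<lambda>x. (x, c x)) ` A"

lemma mem_sample_of [simp]: "(x, b) \<in> sample_of c A \<longleftrightarrow> x \<in> A \<and> c x = b"
  by (auto simp: sample_of_def)

lemma sample_of_subset_iff [simp]:
  "sample_of c A \<subseteq> sample_of c' A' \<longleftrightarrow> A \<subseteq> A' \<and> (\<forall>x\<in>A. c x = c' x)"
  by (auto simp: sample_of_def)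

lemma sample_of_eq_iff:
  "sample_of c A = sample_of c' A' \<longleftrightarrow> A = A' \<and> (\<forall>x\<in>A. c x = c' x)"
  unfolding set_eq_subset[of "sample_of c A"] by auto

lemma consistent_sample_of [simp]:
  "consistent c' (sample_of c A) \<longleftrightarrow> (\<forall>x\<in>A. c' x = c x)"
  by (auto simp: consistent_def sample_of_def)

lemma card_sample_of [simp]: "card (sample_of c A) = card A"
  unfolding sample_of_def by (rule card_image) (simp add: inj_on_def)

lemma finite_sample_of [simp]: "finite A \<Longrightarrow> finite (sample_of c A)"
  by (simp add: sample_of_def)

lemma subset_sample_ofE:
  assumes "S \<subseteq> sample_of c X"
  obtains A where "A \<subseteq> X" "S = sample_of c A"
  using assms unfolding sample_of_def subset_image_iff by blast

text \<open>A subset of the graph of \<open>c\<close> is automatically single-valued and finite.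
  Samples thus become point sets \<open>A\<close> with a concept \<open>c\<close>, and their
  inclusion becomes agreement on \<open>A\<close>.\<close>

lemma consistent_sample_iff:
  assumes "finite X"
  shows "labeled_sample X S \<and> consistent c S \<longleftrightarrow> S \<subseteq> sample_of c X"
proof
  assume "labeled_sample X S \<and> consistent c S"
  then show "S \<subseteq> sample_of c X"
    by (fastforce simp: labeled_sample_def consistent_def)
next
  assume "S \<subseteq> sample_of c X"
  then obtain A where "A \<subseteq> X" "S = sample_of c A"
    by (rule subset_sample_ofE)
  with assms show "labeled_sample X S \<and> consistent c S"
    by (auto simp: labeled_sample_def sample_of_def inj_on_def consistent_def
        intro: finite_subset)
qed

lemma realizable_samples_eq:
  assumes "finite X"
  shows "realizable_samples X C d = {S. (\<exists>c\<in>C. S \<subseteq> sample_of c X) \<and> card S \<le> d}"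
  using consistent_sample_iff[OF assms]
  unfolding realizable_samples_def realizable_def by blast

lemma finite_realizable_samples: "finite X \<Longrightarrow> finite (realizable_samples X C d)"
  by (rule finite_subset[of _ "Pow (X \<times> UNIV)"])
    (auto simp: realizable_samples_def labeled_sample_def)

lemma shattered_iff:
  "shattered C A \<longleftrightarrow> (\<forall>b. \<exists>c\<in>C. \<forall>x\<in>A. c x = b x)"
  by (auto simp: shattered_def realizable_def consistent_def)

lemma saturating_matching_iff:
  assumes "finite X"
  shows "saturating_matching X C M \<longleftrightarrow> (\<forall>c\<in>C. M c \<subseteq> sample_of c X) \<and> inj_on M C"
  unfolding saturating_matching_def using consistent_sample_iff[OF assms] by blast

section \<open>Attained optima for a fixed class\<close>

locale finite_class =
  fixes X :: "'a set" and C :: "'a concept set"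
  assumes concept_class: "concept_class X C"
begin

lemma finite_dom [simp, intro]: "finite X"
  using concept_class by (simp add: concept_class_def)

lemma finite_concepts [simp, intro]: "finite C"
proof (rule finite_subset)
  show "C \<subseteq> X \<rightarrow>\<^sub>E UNIV" using concept_class by (simp add: concept_class_def)
qed (auto intro: finite_PiE)

lemma nonempty: "C \<noteq> {}"
  using concept_class by (simp add: concept_class_def)

lemma concept_eqI: "\<lbrakk>c \<in> C; c' \<in> C; \<And>x. x \<in> X \<Longrightarrow> c x = c' x\<rbrakk> \<Longrightarrow> c = c'"
  using concept_class by (intro PiE_ext[of c X "\<lambda>_. UNIV" c']) (auto simp: concept_class_def)

lemma matching_card_le: "\<lbrakk>saturating_matching X C M; c \<in> C\<rbrakk> \<Longrightarrow> card (M c) \<le> card X"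
  by (metis card_mono card_sample_of finite_dom finite_sample_of saturating_matching_iff)

lemma cost_le_iff: "cost C M \<le> d \<longleftrightarrow> (\<forall>c\<in>C. card (M c) \<le> d)"
  using nonempty by (simp add: cost_def)

lemma card_le_cost: "c \<in> C \<Longrightarrow> card (M c) \<le> cost C M"
  using cost_le_iff by blast

lemma full_matching: "saturating_matching X C (\<lambda>c. sample_of c X)"
  by (auto simp: saturating_matching_iff inj_on_def sample_of_eq_iff intro: concept_eqI)

lemma full_antichain: "antichain_property C (\<lambda>c. sample_of c X)"
  by (auto simp: antichain_property_def intro: concept_eqI)

lemma SMN_le:
  assumes "saturating_matching X C M" "\<And>c. c \<in> C \<Longrightarrow> card (M c) \<le> d"
  shows "SMN X C \<le> d"
proof -
  have "SMN X C \<le> cost C M"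
    unfolding SMN_def using assms(1) by (blast intro: Least_le)
  also have "\<dots> \<le> d"
    using assms(2) by (simp add: cost_le_iff)
  finally show ?thesis .
qed

lemma SMN_attained:
  obtains M where "saturating_matching X C M" "\<And>c. c \<in> C \<Longrightarrow> card (M c) \<le> SMN X C"
proof -
  have "\<exists>M. saturating_matching X C M \<and> cost C M = SMN X C"
    unfolding SMN_def by (rule LeastI) (use full_matching in blast)
  then obtain M where "saturating_matching X C M" "cost C M = SMN X C" by blast
  with card_le_cost[of _ M] show ?thesis by (auto intro!: that)
qed

lemma AMN_le:
  assumes "saturating_matching X C M" "antichain_property C M" "\<And>c. c \<in> C \<Longrightarrow> card (M c) \<le> d"
  shows "AMN X C \<le> d"
proof -
  have "AMN X C \<le> cost C M"
    unfolding AMN_def using assms(1,2) by (blast intro: Least_le)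
  also have "\<dots> \<le> d"
    using assms(3) by (simp add: cost_le_iff)
  finally show ?thesis .
qed

lemma AMN_attained:
  obtains M where "saturating_matching X C M" "antichain_property C M"
    "\<And>c. c \<in> C \<Longrightarrow> card (M c) \<le> AMN X C"
proof -
  have "\<exists>M. saturating_matching X C M \<and> antichain_property C M \<and> cost C M = AMN X C"
    unfolding AMN_def by (rule LeastI) (use full_matching full_antichain in blast)
  then obtain M where "saturating_matching X C M" "antichain_property C M"
    "cost C M = AMN X C" by blast
  with card_le_cost[of _ M] show ?thesis by (auto intro!: that)
qed

lemma matching_image_realizable:
  assumes "saturating_matching X C M" "\<And>c. c \<in> C \<Longrightarrow> card (M c) \<le> d"
  shows "M ` C \<subseteq> realizable_samples X C d" "card (M ` C) = card C"
  using assms by (auto simp: realizable_samples_eq saturating_matching_iff intro: card_image)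

lemma SMN'_le: "card C \<le> card (realizable_samples X C d) \<Longrightarrow> SMN' X C \<le> d"
  unfolding SMN'_def by (rule Least_le)

lemma AMN'_le:
  assumes "A \<subseteq> realizable_samples X C d" "pairwise (\<lambda>S T. \<not> S \<subseteq> T) A" "card A = card C"
  shows "AMN' X C \<le> d"
  unfolding AMN'_def by (rule Least_le) (use assms in blast)

lemma antichain_matching_image:
  assumes "antichain_property C M"
  shows "pairwise (\<lambda>S T. \<not> S \<subseteq> T) (M ` C)"
  using assms by (auto simp: antichain_property_def pairwise_def)

lemma AMN'_attained:
  obtains A where "A \<subseteq> realizable_samples X C (AMN' X C)"
    "pairwise (\<lambda>S T. \<not> S \<subseteq> T) A" "card A = card C"
proof -
  have "\<exists>A \<subseteq> realizable_samples X C (card X).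
      pairwise (\<lambda>S T. \<not> S \<subseteq> T) A \<and> card A = card C"
    using matching_image_realizable[OF full_matching, of "card X"]
      antichain_matching_image[OF full_antichain] by auto
  then have "\<exists>A \<subseteq> realizable_samples X C (AMN' X C).
      pairwise (\<lambda>S T. \<not> S \<subseteq> T) A \<and> card A = card C"
    unfolding AMN'_def by (rule LeastI)
  with that show ?thesis by blast
qed

text \<open>A matching of least total sample size is greedy, since a direct improvement lowers one
  summand and keeps the others. Existence ensures that \<open>GMN\<close> is the \<open>Max\<close>
  of a nonempty set.\<close>

lemma greedy_matching_exists: "\<exists>M. greedy_matching X C M"
proof -
  define total :: "('a concept \<Rightarrow> 'a sample) \<Rightarrow> nat" where "total M = (\<Sum>c\<in>C. card (M c))" for M
  obtain M where M: "saturating_matching X C M"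
    and min: "\<And>M'. saturating_matching X C M' \<Longrightarrow> total M \<le> total M'"
    using arg_min_nat_lemma[of "saturating_matching X C", OF full_matching, of total] by blast
  have "\<not> direct_improvement X C M' M" for M'
  proof
    assume "direct_improvement X C M' M"
    then obtain c where c: "c \<in> C" "\<And>c'. \<lbrakk>c' \<in> C; c' \<noteq> c\<rbrakk> \<Longrightarrow> M' c' = M c'"
      "card (M' c) < card (M c)" and M': "saturating_matching X C M'"
      by (auto simp: direct_improvement_def)
    have "total M' < total M"
      unfolding total_def
    proof (rule sum_strict_mono_ex1)
      show "\<forall>c'\<in>C. card (M' c') \<le> card (M c')"
        using c(2,3) by (metis le_refl less_imp_le)
    qed (use c in auto)
    with min[OF M'] show False by simp
  qed
  with M show ?thesis by (auto simp: greedy_matching_def)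
qed

lemma finite_greedy_costs: "finite {cost C M | M. greedy_matching X C M}"
  by (rule finite_subset[of _ "{..card X}"])
    (auto simp: greedy_matching_def cost_le_iff matching_card_le)

lemma GMN_ge: "\<lbrakk>greedy_matching X C M; c \<in> C\<rbrakk> \<Longrightarrow> card (M c) \<le> GMN X C"
  unfolding GMN_def
  by (rule order_trans[OF card_le_cost Max_ge[OF finite_greedy_costs]]) auto

lemma GMN_le:
  assumes "\<And>M c. \<lbrakk>greedy_matching X C M; c \<in> C\<rbrakk> \<Longrightarrow> card (M c) \<le> d"
  shows "GMN X C \<le> d"
  unfolding GMN_def using finite_greedy_costs greedy_matching_exists assms
  by (auto simp: cost_le_iff)

text \<open>If no other concept used the smaller sample, switching \<open>c\<close> to it would be a direct
  improvement.\<close>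

lemma greedy_subsample_used:
  assumes M: "greedy_matching X C M" and c: "c \<in> C" and A: "A \<subseteq> X" "card A < card (M c)"
  shows "\<exists>c'\<in>C - {c}. M c' = sample_of c A"
proof (rule ccontr)
  assume unused: "\<not> ?thesis"
  have sat: "saturating_matching X C M"
    using M by (simp add: greedy_matching_def)
  let ?M' = "M(c := sample_of c A)"
  have "inj_on ?M' C"
    using sat unused unfolding saturating_matching_iff[OF finite_dom] inj_on_def
    by (auto simp: fun_upd_def)
  then have "saturating_matching X C ?M'"
    using sat A(1) by (auto simp: saturating_matching_iff)
  then have "direct_improvement X C ?M' M"
    unfolding direct_improvement_def using sat c A(2) by auto
  with M show False by (auto simp: greedy_matching_def)
qed

end

section \<open>Teaching sequences, teaching dimension and VC-dimension\<close>

text \<open>One transition of a subset teaching sequence. Finite chains of transitions can be built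
  by induction; the infinite sequence is recovered in \<open>STD_min_le\<close>.\<close>

definition shrinks ::
  "'a concept set \<Rightarrow> ('a concept \<Rightarrow> 'a sample) \<Rightarrow> ('a concept \<Rightarrow> 'a sample) \<Rightarrow> bool" where
  "shrinks C M M' \<longleftrightarrow>
     (\<forall>c\<in>C. M' c \<subseteq> M c \<and> (\<forall>c'\<in>C. c \<noteq> c' \<longrightarrow> \<not> M' c \<subseteq> M c'))"

lemma shrinks_antichain: "shrinks C M M' \<Longrightarrow> antichain_property C M'"
  unfolding shrinks_def antichain_property_def by (meson order_trans)

lemma shrinks_self: "antichain_property C M \<Longrightarrow> shrinks C M M"
  by (auto simp: shrinks_def antichain_property_def)

context finite_class
begin

abbreviation full :: "'a concept \<Rightarrow> 'a sample" where
  "full \<equiv> \<lambda>c. sample_of c X"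

lemma shrinks_from_full:
  assumes "(shrinks C)\<^sup>*\<^sup>* full M"
  shows "antichain_property C M" "\<And>c. c \<in> C \<Longrightarrow> M c \<subseteq> full c"
proof -
  have "antichain_property C M \<and> (\<forall>c\<in>C. M c \<subseteq> full c)"
    using assms
  proof induction
    case base
    then show ?case using full_antichain by simp
  next
    case (step M M')
    then have "\<forall>c\<in>C. M' c \<subseteq> M c" by (simp add: shrinks_def)
    with step show ?case by (meson shrinks_antichain order_trans)
  qed
  then show "antichain_property C M" "\<And>c. c \<in> C \<Longrightarrow> M c \<subseteq> full c" by auto
qed

text \<open>Equal samples are in particular nested, so an antichain is injective; saturation need
  not be tracked along a run.\<close>

lemma antichain_saturating:
  assumes "antichain_property C M" "\<And>c. c \<in> C \<Longrightarrow> M c \<subseteq> full c"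
  shows "saturating_matching X C M"
  unfolding saturating_matching_iff[OF finite_dom]
  using assms by (metis antichain_property_def inj_onI order_refl)

lemma sequence_cost_eventually:
  assumes "\<And>k c. \<lbrakk>n \<le> k; c \<in> C\<rbrakk> \<Longrightarrow> \<M> k c = \<M> n c"
  shows "sequence_cost C \<M> = cost C (\<M> n)"
proof -
  let ?k = "stabilization_index C \<M>"
  have stable: "\<forall>k'\<ge>n. \<forall>c\<in>C. \<M> k' c = \<M> n c" using assms by blast
  then have "?k \<le> n" unfolding stabilization_index_def by (rule Least_le)
  moreover have "\<forall>k'\<ge>?k. \<forall>c\<in>C. \<M> k' c = \<M> ?k c"
    unfolding stabilization_index_def by (rule LeastI) (rule stable)
  ultimately have "\<forall>c\<in>C. \<M> n c = \<M> ?k c" by blast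
  then show ?thesis by (simp add: sequence_cost_def cost_def)
qed

lemma STD_min_le:
  assumes "(shrinks C)\<^sup>*\<^sup>* full M" "\<And>c. c \<in> C \<Longrightarrow> card (M c) \<le> d"
  shows "STD_min X C \<le> d"
proof -
  obtain n where "(shrinks C ^^ n) full M"
    using assms(1) rtranclp_imp_relpowp by metis
  then obtain f where f: "f 0 = full" "f n = M"
    and step: "\<And>i. i < n \<Longrightarrow> shrinks C (f i) (f (Suc i))"
    unfolding relpowp_fun_conv by blast
  have reach: "(shrinks C)\<^sup>*\<^sup>* full (f i)" if "i \<le> n" for i
    using that
  proof (induction i)
    case (Suc i)
    then show ?case
      using rtranclp.rtrancl_into_rtrancl[of "shrinks C", OF _ step[of i]] by simp
  qed (simp add: f)
  \<comment> \<open>The run is frozen at \<open>M\<close>. Repeating the last matching is a legal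
    transition because its antichain property is exactly \<open>shrinks C M M\<close>.\<close>
  define \<M> where "\<M> k = f (min k n)" for k
  have "shrinks C (\<M> k) (\<M> (Suc k))" for k
  proof (cases "k < n")
    case True
    then show ?thesis using step by (simp add: \<M>_def)
  next
    case False
    then have "\<M> k = f n" "\<M> (Suc k) = f n" by (simp_all add: \<M>_def min_def)
    then show ?thesis
      using shrinks_self[OF shrinks_from_full(1)[OF reach[of n]]] by simp
  qed
  then have "\<M> (Suc k) c \<subseteq> \<M> k c" "\<lbrakk>c' \<in> C; c \<noteq> c'\<rbrakk> \<Longrightarrow> \<not> \<M> (Suc k) c \<subseteq> \<M> k c'"
    if "c \<in> C" for k c c'
    using that by (auto simp: shrinks_def)
  moreover have "saturating_matching X C (\<M> k)" for k
    using shrinks_from_full[OF reach[of "min k n"]] unfolding \<M>_def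
    by (intro antichain_saturating) auto
  ultimately have seq: "subset_teaching_sequence X C \<M>"
    unfolding subset_teaching_sequence_def
    by (auto simp: \<M>_def f sample_of_def[symmetric])
  have "sequence_cost C \<M> = cost C (\<M> n)"
    by (rule sequence_cost_eventually) (auto simp: \<M>_def)
  also have "\<dots> \<le> d"
    using assms(2) by (simp add: \<M>_def f cost_le_iff)
  finally have "sequence_cost C \<M> \<le> d" .
  moreover have "STD_min X C \<le> sequence_cost C \<M>"
    unfolding STD_min_def by (rule Least_le) (use seq in blast)
  ultimately show ?thesis by simp
qed

lemma STD_min_attained:
  obtains \<M> where "subset_teaching_sequence X C \<M>" "sequence_cost C \<M> = STD_min X C"
proof -
  have "subset_teaching_sequence X C (\<lambda>_. full)"
    using full_matching full_antichain
    unfolding subset_teaching_sequence_def antichain_property_def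
    by (auto simp: sample_of_def[symmetric])
  then have "\<exists>\<M>. subset_teaching_sequence X C \<M> \<and>
      sequence_cost C \<M> = sequence_cost C (\<lambda>_. full)"
    by blast
  then have "\<exists>\<M>. subset_teaching_sequence X C \<M> \<and> sequence_cost C \<M> = STD_min X C"
    unfolding STD_min_def by (rule LeastI)
  with that show ?thesis by blast
qed

text \<open>Every term of a teaching sequence is already an antichain:
  \<open>\<M> k c \<subseteq> \<M> k c'\<close> would imply
  \<open>\<M> (Suc k) c \<subseteq> \<M> k c'\<close>.\<close>

lemma AMN_le_STD_min: "AMN X C \<le> STD_min X C"
proof -
  obtain \<M> where seq: "subset_teaching_sequence X C \<M>"
    and cost: "sequence_cost C \<M> = STD_min X C"
    by (rule STD_min_attained)
  let ?M = "\<M> (stabilization_index C \<M>)"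
  have "antichain_property C ?M"
    using seq unfolding subset_teaching_sequence_def antichain_property_def
    by (meson order_trans)
  moreover have "saturating_matching X C ?M"
    using seq by (simp add: subset_teaching_sequence_def)
  moreover have "card (?M c) \<le> STD_min X C" if "c \<in> C" for c
    using card_le_cost[OF that, of ?M] cost by (simp add: sequence_cost_def)
  ultimately show ?thesis by (intro AMN_le)
qed

section \<open>Elementary comparisons of the matching parameters\<close>

lemma SMN'_le_SMN: "SMN' X C \<le> SMN X C"
proof -
  obtain M where "saturating_matching X C M" "\<And>c. c \<in> C \<Longrightarrow> card (M c) \<le> SMN X C"
    by (rule SMN_attained) blast
  from matching_image_realizable[OF this] have "card C \<le> card (realizable_samples X C (SMN X C))"
    using card_mono[OF finite_realizable_samples[OF finite_dom]] by metis
  then show ?thesis by (rule SMN'_le)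
qed

lemma SMN'_le_AMN': "SMN' X C \<le> AMN' X C"
proof -
  obtain A where "A \<subseteq> realizable_samples X C (AMN' X C)" "card A = card C"
    by (rule AMN'_attained)
  then have "card C \<le> card (realizable_samples X C (AMN' X C))"
    using card_mono[OF finite_realizable_samples[OF finite_dom]] by metis
  then show ?thesis by (rule SMN'_le)
qed

lemma AMN'_le_AMN: "AMN' X C \<le> AMN X C"
proof -
  obtain M where M: "saturating_matching X C M" "antichain_property C M"
    "\<And>c. c \<in> C \<Longrightarrow> card (M c) \<le> AMN X C"
    by (rule AMN_attained) blast
  show ?thesis
    by (rule AMN'_le[OF matching_image_realizable(1) antichain_matching_image
          matching_image_realizable(2)]) (use M in auto)
qed

lemma SMN_le_AMN: "SMN X C \<le> AMN X C"
proof -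
  obtain M where M: "saturating_matching X C M" "antichain_property C M"
    "\<And>c. c \<in> C \<Longrightarrow> card (M c) \<le> AMN X C"
    by (rule AMN_attained) blast
  then show ?thesis by (intro SMN_le)
qed

lemma SMN_le_GMN: "SMN X C \<le> GMN X C"
proof -
  obtain M where M: "greedy_matching X C M" using greedy_matching_exists by blast
  then have "saturating_matching X C M" by (simp add: greedy_matching_def)
  then show ?thesis by (rule SMN_le) (rule GMN_ge[OF M])
qed

subsection \<open>VC-dimension and recursive teaching dimension\<close>

lemma finite_shattered_cards: "finite {card A | A. A \<subseteq> X \<and> shattered C A}"
proof (rule finite_surj[of "Pow X"])
  show "{card A | A. A \<subseteq> X \<and> shattered C A} \<subseteq> card ` Pow X" by auto
qed simp

lemma card_le_VCD: "\<lbrakk>A \<subseteq> X; shattered C A\<rbrakk> \<Longrightarrow> card A \<le> VCD X C"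
  unfolding VCD_def by (rule Max_ge[OF finite_shattered_cards]) blast

text \<open>The labels of a teaching sample are dictated by \<open>c\<close>, so only its point set
  has to be chosen.\<close>

lemma TD_set_eq:
  assumes "C' \<subseteq> C" "c \<in> C'"
  shows "(\<exists>S. labeled_sample X S \<and> {c' \<in> C'. consistent c' S} = {c} \<and> card S = d) \<longleftrightarrow>
    (\<exists>A\<subseteq>X. (\<forall>c'\<in>C'. (\<forall>x\<in>A. c' x = c x) \<longrightarrow> c' = c) \<and> card A = d)" (is "?L \<longleftrightarrow> ?R")
proof
  assume ?L
  then obtain S where S: "labeled_sample X S" "{c' \<in> C'. consistent c' S} = {c}" "card S = d"
    by blast
  then have "S \<subseteq> full c" using consistent_sample_iff[OF finite_dom] by blast
  then obtain A where A: "A \<subseteq> X" "S = sample_of c A" by (rule subset_sample_ofE)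
  then have "\<forall>c'\<in>C'. (\<forall>x\<in>A. c' x = c x) \<longrightarrow> c' = c" using S(2) by auto
  with A S(3) show ?R by auto
next
  assume ?R
  then obtain A where A: "A \<subseteq> X" "\<forall>c'\<in>C'. (\<forall>x\<in>A. c' x = c x) \<longrightarrow> c' = c" "card A = d"
    by blast
  have "labeled_sample X (sample_of c A)"
    using consistent_sample_iff[OF finite_dom] A(1)
    by (metis sample_of_subset_iff)
  moreover have "{c' \<in> C'. consistent c' (sample_of c A)} = {c}"
    using A(2) assms(2) by auto
  ultimately show ?L using A(3) by (intro exI[of _ "sample_of c A"]) simp
qed

lemma TD_attained:
  assumes "C' \<subseteq> C" "c \<in> C'"
  obtains A where "A \<subseteq> X" "\<And>c'. \<lbrakk>c' \<in> C'; \<And>x. x \<in> A \<Longrightarrow> c' x = c x\<rbrakk> \<Longrightarrow> c' = c"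
    "card A = TD X c C'"
proof -
  have "\<exists>A\<subseteq>X. (\<forall>c'\<in>C'. (\<forall>x\<in>A. c' x = c x) \<longrightarrow> c' = c) \<and> card A = card X"
    using assms by (intro exI[of _ X]) (auto intro: concept_eqI)
  then have "\<exists>A\<subseteq>X. (\<forall>c'\<in>C'. (\<forall>x\<in>A. c' x = c x) \<longrightarrow> c' = c) \<and> card A = TD X c C'"
    unfolding TD_def TD_set_eq[OF assms] by (rule LeastI)
  then obtain A where "A \<subseteq> X" "\<forall>c'\<in>C'. (\<forall>x\<in>A. c' x = c x) \<longrightarrow> c' = c" "card A = TD X c C'"
    by blast
  then show ?thesis by (intro that) auto
qed

lemma finite_RTD_set: "finite {Min ((\<lambda>c. TD X c C') ` C') | C'. C' \<noteq> {} \<and> C' \<subseteq> C}"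
proof (rule finite_surj[of "Pow C"])
  show "{Min ((\<lambda>c. TD X c C') ` C') | C'. C' \<noteq> {} \<and> C' \<subseteq> C}
      \<subseteq> (\<lambda>C'. Min ((\<lambda>c. TD X c C') ` C')) ` Pow C" by auto
qed simp

lemma RTD_ge:
  assumes "\<And>c. c \<in> C \<Longrightarrow> d \<le> TD X c C"
  shows "d \<le> RTD X C"
proof -
  have "d \<le> Min ((\<lambda>c. TD X c C) ` C)" using assms nonempty by simp
  also have "\<dots> \<le> RTD X C"
    unfolding RTD_def by (rule Max_ge[OF finite_RTD_set]) (use nonempty in blast)
  finally show ?thesis .
qed

text \<open>The form in which \<open>RTD\<close> bounds other parameters from above: every nonempty
  subclass has a concept that is cheap to teach, so the class can be dismantled one concept at a
  time.\<close>

lemma RTD_teaches: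
  assumes "C' \<subseteq> C" "C' \<noteq> {}"
  obtains c A where "c \<in> C'" "A \<subseteq> X" "card A \<le> RTD X C"
    "\<And>c'. \<lbrakk>c' \<in> C'; \<And>x. x \<in> A \<Longrightarrow> c' x = c x\<rbrakk> \<Longrightarrow> c' = c"
proof -
  have "finite C'" using assms(1) finite_subset by blast
  then have "Min ((\<lambda>c. TD X c C') ` C') \<in> (\<lambda>c. TD X c C') ` C'"
    using assms(2) by (intro Min_in) auto
  then obtain c where c: "c \<in> C'" "TD X c C' = Min ((\<lambda>c. TD X c C') ` C')" by auto
  have "TD X c C' \<le> RTD X C"
    unfolding RTD_def c(2) by (rule Max_ge[OF finite_RTD_set]) (use assms in blast)
  moreover obtain A where "A \<subseteq> X" "card A = TD X c C'"
    "\<And>c'. \<lbrakk>c' \<in> C'; \<And>x. x \<in> A \<Longrightarrow> c' x = c x\<rbrakk> \<Longrightarrow> c' = c"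
    by (rule TD_attained[OF assms(1) c(1)]) blast
  ultimately show ?thesis using c(1) by (intro that[of c A]) auto
qed

text \<open>Provides room in \<open>X\<close> for padding teaching sets to size exactly
  \<open>RTD X C\<close>.\<close>

lemma RTD_le_card: "RTD X C \<le> card X"
proof -
  have "Min ((\<lambda>c. TD X c C') ` C') \<le> card X" if C': "C' \<noteq> {}" "C' \<subseteq> C" for C'
  proof -
    obtain c where c: "c \<in> C'" using C'(1) by blast
    have "finite C'" using C'(2) finite_subset by blast
    then have "Min ((\<lambda>c. TD X c C') ` C') \<le> TD X c C'" using c by simp
    also obtain A where "A \<subseteq> X" "card A = TD X c C'"
      by (rule TD_attained[OF C'(2) c])
    then have "TD X c C' \<le> card X" using card_mono[OF finite_dom] by metis
    finally show ?thesis .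
  qed
  then show ?thesis
    unfolding RTD_def using finite_RTD_set nonempty by (subst Max_le_iff) auto
qed

text \<open>Process the domain point by point: \<open>c\<close> drops the label of \<open>x\<close> unless the remaining sample
  is contained in the current sample of some other concept \<open>c'\<close>. In the latter case \<open>c\<close> and \<open>c'\<close>
  agree on the points not yet processed but differ at \<open>x\<close>, so that the patterns realized around
  \<open>c\<close> and around \<open>c'\<close> together shatter the points kept by \<open>c\<close>, including \<open>x\<close>.\<close>

lemma shrink_to_shattered:
  assumes "finite B" "B \<subseteq> X"
  shows "\<exists>M. (shrinks C)\<^sup>*\<^sup>* full M \<and> (\<forall>c\<in>C. \<exists>A\<subseteq>B. M c = sample_of c (A \<union> (X - B)) \<and>
     (\<forall>b. \<exists>g\<in>C. (\<forall>y\<in>A. g y = b y) \<and> (\<forall>y\<in>X - B. g y = c y)))"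
  using assms
proof (induction B)
  case empty
  show ?case by (rule exI[of _ full]) auto
next
  case (insert x B)
  then obtain M where M: "(shrinks C)\<^sup>*\<^sup>* full M" and
    ex: "\<forall>c\<in>C. \<exists>A\<subseteq>B. M c = sample_of c (A \<union> (X - B)) \<and>
     (\<forall>b. \<exists>g\<in>C. (\<forall>y\<in>A. g y = b y) \<and> (\<forall>y\<in>X - B. g y = c y))"
    by auto
  obtain K where "\<forall>c\<in>C. K c \<subseteq> B \<and> M c = sample_of c (K c \<union> (X - B)) \<and>
     (\<forall>b. \<exists>g\<in>C. (\<forall>y\<in>K c. g y = b y) \<and> (\<forall>y\<in>X - B. g y = c y))"
    using bchoice[OF ex] ..
  then have K: "\<And>c. c \<in> C \<Longrightarrow> K c \<subseteq> B"
    "\<And>c. c \<in> C \<Longrightarrow> M c = sample_of c (K c \<union> (X - B))"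
    "\<And>c b. c \<in> C \<Longrightarrow> \<exists>g\<in>C. (\<forall>y\<in>K c. g y = b y) \<and> (\<forall>y\<in>X - B. g y = c y)"
    by blast+
  define drop where "drop c = sample_of c (K c \<union> (X - insert x B))" for c
  \<comment> \<open>Every concept is compared with the old samples \<open>M\<close>, so that all
    drops at \<open>x\<close> form a single transition; a concept that keeps \<open>x\<close> is
    safe by the antichain property of \<open>M\<close>.\<close>
  define M' where "M' c = (if \<exists>c'\<in>C. c' \<noteq> c \<and> drop c \<subseteq> M c' then M c else drop c)" for c
  have drop_sub: "drop c \<subseteq> M c" if "c \<in> C" for c
    using K(2)[OF that] by (auto simp: drop_def)
  have ac: "antichain_property C M" by (rule shrinks_from_full(1)[OF M])
  have step: "shrinks C M M'"
    unfolding shrinks_def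
  proof (intro ballI conjI impI)
    fix c assume c: "c \<in> C"
    then show "M' c \<subseteq> M c" using drop_sub by (simp add: M'_def)
    fix c' assume "c' \<in> C" "c \<noteq> c'"
    with c ac show "\<not> M' c \<subseteq> M c'"
      by (auto simp: M'_def antichain_property_def)
  qed
  have reach: "(shrinks C)\<^sup>*\<^sup>* full M'"
    by (rule rtranclp.rtrancl_into_rtrancl[of "shrinks C", OF M step])
  have "\<exists>A\<subseteq>insert x B. M' c = sample_of c (A \<union> (X - insert x B)) \<and>
     (\<forall>b. \<exists>g\<in>C. (\<forall>y\<in>A. g y = b y) \<and> (\<forall>y\<in>X - insert x B. g y = c y))"
    if c: "c \<in> C" for c
  proof (cases "\<exists>c'\<in>C. c' \<noteq> c \<and> drop c \<subseteq> M c'")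
    case False
    then have "M' c = sample_of c (K c \<union> (X - insert x B))"
      by (auto simp: M'_def drop_def)
    moreover have "\<exists>g\<in>C. (\<forall>y\<in>K c. g y = b y) \<and> (\<forall>y\<in>X - insert x B. g y = c y)" for b
      using K(3)[OF c, of b] by blast
    ultimately show ?thesis using K(1)[OF c] by (intro exI[of _ "K c"]) auto
  next
    case True
    then obtain c' where c': "c' \<in> C" "c' \<noteq> c" "drop c \<subseteq> M c'" by blast
    have agree: "K c \<union> (X - insert x B) \<subseteq> K c' \<union> (X - B)"
      "\<forall>y\<in>K c \<union> (X - insert x B). c y = c' y"
      using c'(3) unfolding drop_def K(2)[OF c'(1)] sample_of_subset_iff by auto
    have sub: "K c \<subseteq> K c'" using agree(1) K(1)[OF c] by auto
    \<comment> \<open>All of \<open>M c\<close> except the label of \<open>x\<close> lies in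
      \<open>M c'\<close>, and \<open>M c'\<close> still has a label at \<open>x\<close>; so the
      antichain property forces the disagreement to be there.\<close>
    have "\<not> M c \<subseteq> M c'" using ac c c' by (auto simp: antichain_property_def)
    then have x: "c x \<noteq> c' x"
      using agree sub insert.prems unfolding K(2)[OF c] K(2)[OF c'(1)] sample_of_subset_iff
      by auto
    have xB: "x \<in> X - B" using insert.hyps insert.prems by auto
    have "K c \<union> (X - B) = insert x (K c) \<union> (X - insert x B)" using xB by auto
    then have "M' c = sample_of c (insert x (K c) \<union> (X - insert x B))"
      using True K(2)[OF c] by (simp add: M'_def)
    moreover have "\<exists>g\<in>C. (\<forall>y\<in>insert x (K c). g y = b y) \<and> (\<forall>y\<in>X - insert x B. g y = c y)" for b
    proof (cases "b x = c x")
      case True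
      obtain g where "g \<in> C" "\<forall>y\<in>K c. g y = b y" "\<forall>y\<in>X - B. g y = c y"
        using K(3)[OF c, of b] by blast
      then show ?thesis using True xB by (intro bexI[of _ g]) auto
    next
      case False
      with x have "b x = c' x" by auto
      obtain g where g: "g \<in> C" "\<forall>y\<in>K c'. g y = b y" "\<forall>y\<in>X - B. g y = c' y"
        using K(3)[OF c'(1), of b] by blast
      have "\<forall>y\<in>insert x (K c). g y = b y" using g sub \<open>b x = c' x\<close> xB by auto
      moreover have "\<forall>y\<in>X - insert x B. g y = c y" using g(3) agree(2) by auto
      ultimately show ?thesis using g(1) by blast
    qed
    ultimately show ?thesis using K(1)[OF c] by (intro exI[of _ "insert x (K c)"]) auto
  qed
  with reach show ?case by blast
qed

lemma STD_min_le_VCD: "STD_min X C \<le> VCD X C"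
proof -
  obtain M where M: "(shrinks C)\<^sup>*\<^sup>* full M" and
    ex: "\<forall>c\<in>C. \<exists>A\<subseteq>X. M c = sample_of c (A \<union> (X - X)) \<and>
     (\<forall>b. \<exists>g\<in>C. (\<forall>y\<in>A. g y = b y) \<and> (\<forall>y\<in>X - X. g y = c y))"
    using shrink_to_shattered[OF finite_dom order_refl] by (elim exE conjE) (rule that)
  show ?thesis
  proof (rule STD_min_le[OF M])
    fix c assume "c \<in> C"
    with ex obtain A where "A \<subseteq> X" "M c = sample_of c A" "\<forall>b. \<exists>g\<in>C. \<forall>y\<in>A. g y = b y"
      by auto
    then show "card (M c) \<le> VCD X C" by (simp add: shattered_iff card_le_VCD)
  qed
qed

text \<open>Teach the concepts one after another; padding all teaching sets to the same size makes
  inclusion among them amount to equality.\<close>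

lemma STD_min_le_RTD: "STD_min X C \<le> RTD X C"
proof -
  let ?d = "RTD X C"
  \<comment> \<open>\<open>C'\<close> collects the concepts not yet taught, which keep their full
    samples. A taught concept has a sample of size \<open>?d\<close> with which no untaught concept
    is consistent.\<close>
  have "STD_min X C \<le> ?d"
    if "C' \<subseteq> C" "(shrinks C)\<^sup>*\<^sup>* full M" "\<forall>c\<in>C'. M c = full c"
      "\<forall>c\<in>C - C'. card (M c) = ?d \<and> (\<forall>c'\<in>C'. \<not> M c \<subseteq> full c')" for C' M
    using finite_subset[OF that(1) finite_concepts] that
  proof (induction C' arbitrary: M rule: finite_psubset_induct)
    case (psubset C')
    show ?case
    proof (cases "C' = {}")
      case True
      with psubset.prems show ?thesis by (intro STD_min_le) auto
    next
      case False
      obtain c A where c: "c \<in> C'" "A \<subseteq> X" "card A \<le> ?d"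
        "\<And>c'. \<lbrakk>c' \<in> C'; \<And>x. x \<in> A \<Longrightarrow> c' x = c x\<rbrakk> \<Longrightarrow> c' = c"
        by (rule RTD_teaches[OF psubset.prems(1) False]) blast
      obtain B where B: "A \<subseteq> B" "B \<subseteq> X" "card B = ?d"
        using exists_subset_between[OF c(3) RTD_le_card c(2) finite_dom] by blast
      have cC: "c \<in> C" using c(1) psubset.prems(1) by blast
      define S where "S = sample_of c B"
      have S_unique: "c' = c" if "c' \<in> C'" "S \<subseteq> full c'" for c'
        using that B(1) c(4)[of c'] unfolding S_def sample_of_subset_iff by auto
      have S: "S \<subseteq> full c" "card S = ?d" using B by (auto simp: S_def)
      have sub: "M c' \<subseteq> full c'" if "c' \<in> C" for c'
        by (rule shrinks_from_full(2)[OF psubset.prems(2) that])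
      \<comment> \<open>An untaught \<open>c'\<close> is excluded by the uniqueness of
        \<open>S\<close>. For a taught \<open>c'\<close> equal sizes would force
        \<open>S = M c'\<close>, placing \<open>M c'\<close> inside the full sample of
        \<open>c\<close>, which was untaught until now.\<close>
      have S_new: "\<not> S \<subseteq> M c'" if "c' \<in> C" "c' \<noteq> c" for c'
      proof (cases "c' \<in> C'")
        case True
        with S_unique that sub show ?thesis by blast
      next
        case False
        with that psubset.prems(4) have "card (M c') = ?d" "\<not> M c' \<subseteq> full c"
          using c(1) by auto
        moreover have "finite (M c')"
          by (rule finite_subset[OF sub[OF that(1)]]) simp
        ultimately show ?thesis using S card_subset_eq[of "M c'" S] by auto
      qed
      let ?M = "M(c := S)"
      have ac: "antichain_property C M" by (rule shrinks_from_full(1)[OF psubset.prems(2)])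
      have "M c = full c" using psubset.prems(3) c(1) by blast
      then have "shrinks C M ?M"
        using ac S_new S(1) unfolding shrinks_def antichain_property_def by auto
      then have reach: "(shrinks C)\<^sup>*\<^sup>* full ?M"
        by (rule rtranclp.rtrancl_into_rtrancl[of "shrinks C", OF psubset.prems(2)])
      show ?thesis
      proof (rule psubset.IH[OF _ _ reach])
        show "C' - {c} \<subset> C'" "C' - {c} \<subseteq> C" using c(1) psubset.prems(1) by auto
        show "\<forall>c'\<in>C' - {c}. ?M c' = full c'" using psubset.prems(3) by auto
        show "\<forall>c1\<in>C - (C' - {c}). card (?M c1) = ?d \<and> (\<forall>c'\<in>C' - {c}. \<not> ?M c1 \<subseteq> full c')"
          using psubset.prems(4) S(2) S_unique by auto
      qed
    qed
  qed
  from this[of C full] show ?thesis by auto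
qed

end

section \<open>Counting bounds\<close>

text \<open>Doubles as the set of squarefree monomials of degree at most \<open>d\<close>.\<close>

definition subsets_upto :: "'a set \<Rightarrow> nat \<Rightarrow> 'a set set" where
  "subsets_upto X d = {A. A \<subseteq> X \<and> card A \<le> d}"

lemma card_subsets_upto:
  assumes "finite X"
  shows "card (subsets_upto X d) = (\<Sum>i\<le>d. card X choose i)"
proof -
  have "subsets_upto X d = (\<Union>i\<in>{..d}. {A. A \<subseteq> X \<and> card A = i})"
    by (auto simp: subsets_upto_def)
  moreover have "card (\<Union>i\<in>{..d}. {A. A \<subseteq> X \<and> card A = i}) =
      (\<Sum>i\<le>d. card {A. A \<subseteq> X \<and> card A = i})"
    using assms by (intro card_UN_disjoint) auto
  ultimately show ?thesis using n_subsets[OF assms] by simp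
qed

lemma finite_subsets_upto: "finite X \<Longrightarrow> finite (subsets_upto X d)"
  by (simp add: subsets_upto_def)

text \<open>Replaces extensionality in inductions on the domain: a slice still consists of functions
  on the larger domain and need not be a concept class over the smaller one, but it stays
  separated.\<close>

definition separated :: "'a set \<Rightarrow> 'a concept set \<Rightarrow> bool" where
  "separated X C \<longleftrightarrow> (\<forall>c\<in>C. \<forall>c'\<in>C. (\<forall>x\<in>X. c x = c' x) \<longrightarrow> c = c')"

definition slice :: "'a concept set \<Rightarrow> 'a \<Rightarrow> bool \<Rightarrow> 'a concept set" where
  "slice C x b = {c \<in> C. c x = b}"

lemma separated_slice: "separated (insert x X) C \<Longrightarrow> separated X (slice C x b)"
  by (auto simp: separated_def slice_def)

lemma finite_slice: "finite C \<Longrightarrow> finite (slice C x b)"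
  by (simp add: slice_def)

lemma card_slices:
  assumes "finite C"
  shows "card C = card (slice C x b) + card (slice C x (\<not> b))"
proof -
  have "C = slice C x b \<union> slice C x (\<not> b)" by (auto simp: slice_def)
  moreover have "slice C x b \<inter> slice C x (\<not> b) = {}" by (auto simp: slice_def)
  ultimately show ?thesis using card_Un_disjoint finite_slice[OF assms] by metis
qed

subsection \<open>Pajor's form of Sauer's lemma\<close>

text \<open>A set shattered by both slices at \<open>x\<close> accounts for two shattered sets of
  \<open>C\<close>, itself and itself with \<open>x\<close> added, so the numbers for the slices add
  up.\<close>

lemma card_le_shattered:
  assumes "finite X" "finite C" "separated X C"
  shows "card C \<le> card {A. A \<subseteq> X \<and> shattered C A}"
  using assms
proof (induction X arbitrary: C)
  case empty
  show ?case
  proof (cases "C = {}")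
    case False
    then obtain c where "c \<in> C" by blast
    with empty have "C = {c}" by (auto simp: separated_def)
    moreover have "{A. A \<subseteq> {} \<and> shattered {c} A} = {{}}" by (auto simp: shattered_iff)
    ultimately show ?thesis by simp
  qed simp
next
  case (insert x X)
  define Sh where "Sh b = {A. A \<subseteq> X \<and> shattered (slice C x b) A}" for b
  have fin: "finite (Sh b)" for b using insert.hyps by (simp add: Sh_def)
  have IH: "card (slice C x b) \<le> card (Sh b)" for b
    unfolding Sh_def
    by (intro insert.IH finite_slice separated_slice insert.prems)
  let ?U = "Sh True \<union> Sh False" and ?I = "insert x ` (Sh True \<inter> Sh False)"
  have "inj_on (insert x) (Sh True \<inter> Sh False)"
  proof (rule inj_onI)
    fix A B assume "A \<in> Sh True \<inter> Sh False" "B \<in> Sh True \<inter> Sh False" "insert x A = insert x B"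
    moreover from this insert.hyps have "x \<notin> A" "x \<notin> B" by (auto simp: Sh_def)
    ultimately show "A = B" by (simp add: insert_ident)
  qed
  then have "card (Sh True) + card (Sh False) = card ?U + card ?I"
    using card_Un_Int[OF fin fin, of True False] by (simp add: card_image)
  also have "\<dots> = card (?U \<union> ?I)"
    using fin insert.hyps by (subst card_Un_disjoint) (auto simp: Sh_def)
  also have "\<dots> \<le> card {A. A \<subseteq> insert x X \<and> shattered C A}"
  proof (rule card_mono)
    show "finite {A. A \<subseteq> insert x X \<and> shattered C A}" using insert.hyps by simp
    have "shattered C A" if "A \<in> ?U" for A
      using that unfolding Sh_def shattered_iff slice_def by blast
    moreover have "shattered C (insert x A)" if A: "A \<in> Sh True \<inter> Sh False" for A
      unfolding shattered_iff
    proof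
      fix b
      from A have "A \<in> Sh (b x)" by (cases "b x") auto
      then obtain c where "c \<in> slice C x (b x)" "\<forall>y\<in>A. c y = b y"
        unfolding Sh_def shattered_iff by blast
      then show "\<exists>c\<in>C. \<forall>y\<in>insert x A. c y = b y"
        by (intro bexI[of _ c]) (auto simp: slice_def)
    qed
    ultimately show "?U \<union> ?I \<subseteq> {A. A \<subseteq> insert x X \<and> shattered C A}"
      by (auto simp: Sh_def)
  qed
  finally show ?case
    using IH[of True] IH[of False] card_slices[OF insert.prems(1), of x True] by simp
qed

subsection \<open>Monomials over the field with two elements\<close>

text \<open>\<open>parity F\<close> is the multilinear polynomial over GF(2) with monomials \<open>F\<close>.\<close>

definition parity :: "'a set set \<Rightarrow> 'a concept \<Rightarrow> bool" where
  "parity F c = odd (card {A \<in> F. \<forall>x\<in>A. c x})"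

text \<open>Addition of polynomials over GF(2): common monomials cancel.\<close>

lemma parity_sym_diff:
  assumes "finite F" "finite G"
  shows "parity ((F - G) \<union> (G - F)) c \<longleftrightarrow> parity F c \<noteq> parity G c"
proof -
  let ?p = "\<lambda>F. {A \<in> F. \<forall>x\<in>A. c x}"
  have "card (?p ((F - G) \<union> (G - F))) = card (?p F - ?p G) + card (?p G - ?p F)"
    using assms by (subst card_Un_disjoint[symmetric]) (auto intro!: arg_cong[of _ _ card])
  moreover have "card (?p F) = card (?p F - ?p G) + card (?p F \<inter> ?p G)"
    using assms by (subst card_Un_disjoint[symmetric]) (auto intro!: arg_cong[of _ _ card])
  moreover have "card (?p G) = card (?p G - ?p F) + card (?p F \<inter> ?p G)"
    using assms by (subst card_Un_disjoint[symmetric]) (auto intro!: arg_cong[of _ _ card])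
  ultimately show ?thesis unfolding parity_def by presburger
qed

text \<open>The product of the factors \<open>x\<close> for positive and \<open>1 + x\<close> for negative labels, expanded.\<close>

lemma parity_interval:
  assumes "finite D" "P \<subseteq> D"
  shows "parity {A. P \<subseteq> A \<and> A \<subseteq> D} c \<longleftrightarrow> (\<forall>x\<in>D. c x \<longleftrightarrow> x \<in> P)"
proof -
  let ?E = "{x \<in> D. c x}"
  have eq: "{A \<in> {A. P \<subseteq> A \<and> A \<subseteq> D}. \<forall>x\<in>A. c x} = {A. P \<subseteq> A \<and> A \<subseteq> ?E}" by auto
  show ?thesis
  proof (cases "P \<subseteq> ?E")
    case True
    have "{A. P \<subseteq> A \<and> A \<subseteq> ?E} = (\<union>) P ` Pow (?E - P)"
    proof (intro equalityI subsetI)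
      fix A assume "A \<in> {A. P \<subseteq> A \<and> A \<subseteq> ?E}"
      then have "A = P \<union> (A - P)" "A - P \<in> Pow (?E - P)" by auto
      then show "A \<in> (\<union>) P ` Pow (?E - P)" by blast
    qed (use True in auto)
    moreover have "inj_on ((\<union>) P) (Pow (?E - P))" by (auto simp: inj_on_def)
    ultimately have "card {A. P \<subseteq> A \<and> A \<subseteq> ?E} = 2 ^ card (?E - P)"
      using assms(1) by (simp add: card_image card_Pow)
    then have "parity {A. P \<subseteq> A \<and> A \<subseteq> D} c \<longleftrightarrow> card (?E - P) = 0"
      unfolding parity_def eq by simp
    also have "\<dots> \<longleftrightarrow> ?E - P = {}" using assms(1) by simp
    also have "\<dots> \<longleftrightarrow> (\<forall>x\<in>D. c x \<longleftrightarrow> x \<in> P)" using True by auto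
    finally show ?thesis .
  next
    case False
    then have none: "{A. P \<subseteq> A \<and> A \<subseteq> ?E} = {}" by auto
    have "\<not> parity {A. P \<subseteq> A \<and> A \<subseteq> D} c" unfolding parity_def eq none by simp
    with False assms(2) show ?thesis by auto
  qed
qed

text \<open>The \<open>2 ^ card \<A>\<close> polynomials must produce all \<open>2 ^ card C\<close>
  functions on the class; this count replaces a rank argument.\<close>

lemma card_le_if_parities_span:
  assumes "finite C" "finite \<A>"
    and span: "\<And>g. \<exists>F\<subseteq>\<A>. \<forall>c\<in>C. parity F c = g c"
  shows "card C \<le> card \<A>"
proof -
  have "C \<rightarrow>\<^sub>E (UNIV :: bool set) \<subseteq> (\<lambda>F. restrict (parity F) C) ` Pow \<A>"
  proof
    fix g :: "'a concept \<Rightarrow> bool" assume g: "g \<in> C \<rightarrow>\<^sub>E UNIV"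
    obtain F where "F \<subseteq> \<A>" "\<forall>c\<in>C. parity F c = g c" using span by blast
    moreover from this g have "g = restrict (parity F) C"
      by (intro extensionalityI[of _ C]) (auto simp: PiE_def)
    ultimately show "g \<in> (\<lambda>F. restrict (parity F) C) ` Pow \<A>" by blast
  qed
  then have "card (C \<rightarrow>\<^sub>E (UNIV :: bool set)) \<le> card (Pow \<A>)"
    using surj_card_le[of "Pow \<A>"] assms(2) by simp
  then have "(2::nat) ^ card C \<le> 2 ^ card \<A>"
    using assms(1,2) by (simp add: card_PiE card_Pow)
  then show ?thesis by simp
qed

subsection \<open>Samples of fixed size\<close>

definition exact_samples :: "'a set \<Rightarrow> 'a concept set \<Rightarrow> nat \<Rightarrow> 'a sample set" where
  "exact_samples X C d = {sample_of c A | c A. c \<in> C \<and> A \<subseteq> X \<and> card A = d}"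

lemma finite_exact_samples:
  assumes "finite X"
  shows "finite (exact_samples X C d)"
  by (rule finite_subset[of _ "Pow (X \<times> UNIV)"]) (use assms in \<open>auto simp: exact_samples_def\<close>)

lemma card_exact_sample: "S \<in> exact_samples X C d \<Longrightarrow> card S = d"
  by (auto simp: exact_samples_def)

lemma insert_exact_sample:
  assumes "finite X" "x \<in> X" "S \<in> exact_samples (X - {x}) (slice C x b) d"
  shows "insert (x, b) S \<in> exact_samples X C (Suc d)"
proof -
  obtain c A where c: "c \<in> C" "c x = b" "A \<subseteq> X - {x}" "card A = d" "S = sample_of c A"
    using assms(3) by (auto simp: exact_samples_def slice_def)
  have "finite A" using c(3) assms(1) finite_subset by blast
  with c have "card (insert x A) = Suc d" by (subst card_insert_disjoint) auto
  moreover have "insert (x, b) S = sample_of c (insert x A)" using c by (simp add: sample_of_def)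
  ultimately show ?thesis using c assms(2) by (auto simp: exact_samples_def intro!: exI[of _ c])
qed

lemma exact_samples_fst:
  "\<lbrakk>S \<in> exact_samples (X - {x}) C d; (y, b) \<in> S\<rbrakk> \<Longrightarrow> y \<in> X \<and> y \<noteq> x"
  by (auto simp: exact_samples_def)

lemma inj_on_insert_exact_samples: "inj_on (insert (x, b)) (exact_samples (X - {x}) C d)"
proof (rule inj_onI)
  fix S T assume *: "S \<in> exact_samples (X - {x}) C d" "T \<in> exact_samples (X - {x}) C d"
    "insert (x, b) S = insert (x, b) T"
  have "(x, b) \<notin> S" "(x, b) \<notin> T" using *(1,2) by (auto simp: exact_samples_def)
  with *(3) show "S = T" by (simp add: insert_ident)
qed

text \<open>The samples avoiding \<open>x\<close> are taken from one slice only, because both slices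
  may realize the same ones; those containing \<open>x\<close> are told apart by its label.\<close>

lemma card_exact_samples_slices:
  assumes "finite X" "x \<in> X"
  shows "card (exact_samples (X - {x}) (slice C x b) (Suc d))
      + card (exact_samples (X - {x}) (slice C x False) d)
      + card (exact_samples (X - {x}) (slice C x True) d)
    \<le> card (exact_samples X C (Suc d))"
proof -
  let ?E = "exact_samples (X - {x})"
  let ?N = "?E (slice C x b) (Suc d)"
  let ?I = "\<lambda>b. insert (x, b) ` ?E (slice C x b) d"
  have fin: "finite (?E C' d')" for C' d' using assms(1) by (intro finite_exact_samples) simp
  have N: "\<not> (x, b') \<in> S" if "S \<in> ?E C' d'" for S b' C' d' using exact_samples_fst[OF that] by blast
  have "?N \<inter> ?I False = {}" "?N \<inter> ?I True = {}" "?I False \<inter> ?I True = {}"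
    using N by (auto dest!: N)
  then have "card (?N \<union> ?I False \<union> ?I True) = card ?N + card (?I False) + card (?I True)"
    using fin by (simp add: card_Un_disjoint Int_Un_distrib2)
  moreover have "card (?I b') = card (?E (slice C x b') d)" for b'
    by (rule card_image[OF inj_on_insert_exact_samples])
  moreover have "?N \<union> ?I False \<union> ?I True \<subseteq> exact_samples X C (Suc d)"
  proof -
    have "?N \<subseteq> exact_samples X C (Suc d)" by (fastforce simp: exact_samples_def slice_def)
    with insert_exact_sample[OF assms] show ?thesis by blast
  qed
  ultimately show ?thesis using card_mono[OF finite_exact_samples[OF assms(1)]] by metis
qed

text \<open>Double counting: adding a labeled point to a sample of its slice gives a sample of size
  \<open>Suc d\<close> with a marked element, and each such sample has \<open>Suc d\<close> elements
  to mark.\<close>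

lemma sum_card_exact_samples:
  assumes "finite X"
  shows "(\<Sum>x\<in>X. \<Sum>b\<in>UNIV. card (exact_samples (X - {x}) (slice C x b) d))
    \<le> Suc d * card (exact_samples X C (Suc d))"
proof -
  let ?E = "\<lambda>p. exact_samples (X - {fst p}) (slice C (fst p) (snd p)) d"
  let ?P = "SIGMA p:X \<times> UNIV. ?E p" and ?Q = "SIGMA S:exact_samples X C (Suc d). S"
  have fin: "finite (?E p)" for p using assms by (intro finite_exact_samples) simp
  have finS: "finite S" if "S \<in> exact_samples X C (Suc d)" for S
    using card_exact_sample[OF that] card.infinite by fastforce
  have "(\<Sum>x\<in>X. \<Sum>b\<in>UNIV. card (exact_samples (X - {x}) (slice C x b) d)) = card ?P"
    using assms fin by (simp add: sum.cartesian_product case_prod_beta)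
  also have "\<dots> \<le> card ?Q"
  proof (rule card_inj_on_le[where f = "\<lambda>(p, S). (insert p S, p)"])
    show "inj_on (\<lambda>(p, S). (insert p S, p)) ?P"
    proof (rule inj_onI)
      fix u v assume uv: "u \<in> ?P" "v \<in> ?P" "(case u of (p, S) \<Rightarrow> (insert p S, p)) =
        (case v of (p, S) \<Rightarrow> (insert p S, p))"
      obtain x b S S' where "u = ((x, b), S)" "v = ((x, b), S')"
        using uv(3) by (cases u; cases v) auto
      with uv show "u = v"
        using inj_onD[OF inj_on_insert_exact_samples[of x b X "slice C x b" d], of S S'] by simp
    qed
    show "(\<lambda>(p, S). (insert p S, p)) ` ?P \<subseteq> ?Q"
      using insert_exact_sample[OF assms] by auto
    show "finite ?Q" using finite_exact_samples[OF assms] finS by auto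
  qed
  also have "\<dots> = (\<Sum>S\<in>exact_samples X C (Suc d). card S)"
    using finite_exact_samples[OF assms] finS by simp
  also have "\<dots> = Suc d * card (exact_samples X C (Suc d))"
    by (simp add: card_exact_sample)
  finally show ?thesis .
qed

text \<open>Unimodality: past the middle, \<open>i\<close> is reflected to \<open>n - i\<close>,
  which \<open>i + j \<le> n\<close> keeps at least \<open>j\<close>.\<close>

lemma binomial_le_binomial:
  assumes "j \<le> i" "i + j \<le> n"
  shows "n choose j \<le> n choose i"
proof (cases "2 * i \<le> n")
  case True
  with assms show ?thesis by (intro binomial_mono) auto
next
  case False
  have "n choose j \<le> n choose (n - i)"
    using assms False by (intro binomial_mono) auto
  also have "\<dots> = n choose i" using assms by (intro binomial_symmetric[symmetric]) auto
  finally show ?thesis .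
qed

text \<open>Pair \<open>i\<close> with \<open>d - i\<close>: the larger index carries the larger binomial coefficient.\<close>

lemma sum_binomial_mean:
  fixes n d :: nat
  assumes "d \<le> n"
  shows "d * (\<Sum>i\<le>d. n choose i) \<le> 2 * (\<Sum>i\<le>d. i * (n choose i))"
proof -
  \<comment> \<open>The weight changes sign when \<open>i\<close> becomes \<open>d - i\<close>;
    integers are used because it is negative for small \<open>i\<close>.\<close>
  let ?f = "\<lambda>i. (2 * int i - int d) * int (n choose i)"
  have rev: "(\<Sum>i\<le>d. ?f i) = (\<Sum>i\<le>d. ?f (d - i))"
    using sum.nat_diff_reindex[of ?f "Suc d"] by (simp add: lessThan_Suc_atMost)
  have "0 \<le> (\<Sum>i\<le>d. ?f i + ?f (d - i))"
  proof (rule sum_nonneg)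
    fix i assume "i \<in> {..d}"
    then have i: "i \<le> d" by simp
    have "?f i + ?f (d - i) = (2 * int i - int d) * (int (n choose i) - int (n choose (d - i)))"
      using i by (simp add: of_nat_diff algebra_simps)
    also have "\<dots> \<ge> 0"
    proof (cases "d \<le> 2 * i")
      case True
      then have "n choose (d - i) \<le> n choose i"
        using assms i by (intro binomial_le_binomial) auto
      with True show ?thesis by simp
    next
      case False
      then have "n choose i \<le> n choose (d - i)"
        using assms i by (intro binomial_le_binomial) auto
      with False show ?thesis by (intro mult_nonpos_nonpos) auto
    qed
    finally show "0 \<le> ?f i + ?f (d - i)" .
  qed
  also have "\<dots> = 2 * (\<Sum>i\<le>d. ?f i)" using rev by (simp add: sum.distrib)
  finally have "0 \<le> (\<Sum>i\<le>d. ?f i)" by simp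
  also have "\<dots> = int (2 * (\<Sum>i\<le>d. i * (n choose i))) - int (d * (\<Sum>i\<le>d. n choose i))"
    by (simp add: sum_distrib_left sum_subtractf left_diff_distrib algebra_simps)
  finally show ?thesis by linarith
qed

lemma sum_binomial_Suc:
  "(\<Sum>i\<le>Suc d. Suc n choose i) = (\<Sum>i\<le>Suc d. n choose i) + (\<Sum>i\<le>d. n choose i)"
proof -
  have "(\<Sum>i\<le>Suc d. Suc n choose i) = 1 + (\<Sum>i\<le>d. Suc n choose Suc i)"
    by (subst sum.atMost_Suc_shift) simp
  also have "\<dots> = (1 + (\<Sum>i\<le>d. n choose Suc i)) + (\<Sum>i\<le>d. n choose i)"
    by (simp add: sum.distrib)
  also have "1 + (\<Sum>i\<le>d. n choose Suc i) = (\<Sum>i\<le>Suc d. n choose i)"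
    by (subst sum.atMost_Suc_shift) simp
  finally show ?thesis .
qed

text \<open>If some point splits \<open>C\<close> so that one part is small, delete that point and use the larger
  part as a transversal of the projection; otherwise every part is large, and averaging over the
  point that is deleted from a sample suffices.\<close>

lemma card_exact_samples_ge:
  assumes "finite X" "finite C" "separated X C" "d \<le> card X"
  shows "min (card C) (\<Sum>i\<le>d. card X choose i) \<le> card (exact_samples X C d)"
  using assms
proof (induction "card X" arbitrary: X C d rule: less_induct)
  case less
  show ?case
  proof (cases "d = card X")
    \<comment> \<open>Deleting a point would leave no room for \<open>d\<close> points, outside the
      reach of the induction hypothesis; here the samples are the concepts themselves.\<close>
    case True
    have "inj_on (\<lambda>c. sample_of c X) C"
      using less.prems(3) by (auto simp: inj_on_def separated_def sample_of_eq_iff)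
    then have "card C = card ((\<lambda>c. sample_of c X) ` C)" by (simp add: card_image)
    also have "\<dots> \<le> card (exact_samples X C d)"
      using True by (intro card_mono finite_exact_samples less.prems(1)) (auto simp: exact_samples_def)
    finally show ?thesis by simp
  next
    case False
    show ?thesis
    proof (cases d)
      case 0
      show ?thesis
      proof (cases "C = {}")
        case False
        then have "{} \<in> exact_samples X C 0"
          by (auto simp: exact_samples_def sample_of_def intro!: exI[of _ "{}"])
        then have "1 \<le> card (exact_samples X C 0)"
          using finite_exact_samples[OF less.prems(1)] by (metis One_nat_def Suc_leI card_gt_0_iff empty_iff)
        with 0 show ?thesis by simp
      qed simp
    next
      case (Suc e)
      with False less.prems(4) obtain n where n: "card X = Suc n" "Suc e \<le> n"
        by (cases "card X") auto
      let ?\<Phi> = "\<lambda>d. \<Sum>i\<le>d. n choose i"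
      have IH: "min (card (slice C x b)) (?\<Phi> d') \<le> card (exact_samples (X - {x}) (slice C x b) d')"
        if "x \<in> X" "d' \<le> n" for x b d'
      proof -
        have cX: "card (X - {x}) = n" using that(1) n(1) less.prems(1) by simp
        have "separated (X - {x}) (slice C x b)"
          using that(1) less.prems(3) by (intro separated_slice) (simp add: insert_absorb)
        with less.hyps[of "X - {x}" "slice C x b" d'] that(2) show ?thesis
          using less.prems(1,2) n(1) by (simp add: cX finite_slice)
      qed
      show ?thesis
      proof (cases "\<exists>x\<in>X. \<exists>b. card (slice C x b) \<le> ?\<Phi> e")
        case True
        then obtain x where x: "x \<in> X" "\<exists>b. card (slice C x b) \<le> ?\<Phi> e" by blast
        obtain b where b: "card (slice C x (\<not> b)) \<le> ?\<Phi> e"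
          "card (slice C x (\<not> b)) \<le> card (slice C x b)"
        proof (cases "card (slice C x True) \<le> card (slice C x False)")
          case True
          with x(2) show ?thesis by (intro that[of False]) (auto, metis (full_types) le_trans)
        next
          case False
          with x(2) show ?thesis by (intro that[of True]) (auto, metis (full_types) le_trans nat_le_linear)
        qed
        have "card (exact_samples (X - {x}) (slice C x b) (Suc e))
          + card (exact_samples (X - {x}) (slice C x b) e)
          + card (exact_samples (X - {x}) (slice C x (\<not> b)) e) \<le> card (exact_samples X C (Suc e))"
          using card_exact_samples_slices[OF less.prems(1) x(1), of C b e] by (cases b) auto
        moreover have "card C = card (slice C x b) + card (slice C x (\<not> b))"
          by (rule card_slices[OF less.prems(2)])
        \<comment> \<open>If \<open>card (slice C x b)\<close> is at most
          \<open>?\<Phi> (Suc e)\<close>, the first and third summands already give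
          \<open>card C\<close>; otherwise the first two give
          \<open>?\<Phi> (Suc e) + ?\<Phi> e\<close>, the required sum by Pascal's rule.\<close>
        ultimately show ?thesis
          using IH[OF x(1) n(2), of b] IH[OF x(1), of e b] IH[OF x(1), of e "\<not> b"] b n
          unfolding Suc n(1) sum_binomial_Suc min_def by (simp split: if_splits)
      next
        case False
        then have large: "?\<Phi> e \<le> card (slice C x b)" if "x \<in> X" for x b
          using that by (meson nat_le_linear)
        \<comment> \<open>A set of at most \<open>Suc e\<close> points has on average at least
          \<open>Suc e / 2\<close> elements, and there are \<open>Suc n * ?\<Phi> e\<close> such
          sets with a marked element. Each of the \<open>2 * Suc n\<close> slices supplies at least
          \<open>?\<Phi> e\<close> samples, so the factor \<open>Suc e\<close> cancels in the
          end.\<close>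
        have "Suc e * (\<Sum>i\<le>Suc e. Suc n choose i) \<le> 2 * (\<Sum>i\<le>Suc e. i * (Suc n choose i))"
          using n(2) by (intro sum_binomial_mean) simp
        also have "(\<Sum>i\<le>Suc e. i * (Suc n choose i)) = Suc n * ?\<Phi> e"
        proof -
          have "(\<Sum>i\<le>Suc e. i * (Suc n choose i)) = (\<Sum>i\<le>e. Suc i * (Suc n choose Suc i))"
            by (subst sum.atMost_Suc_shift) simp
          also have "\<dots> = (\<Sum>i\<le>e. Suc n * (n choose i))"
            by (intro sum.cong refl Suc_times_binomial)
          finally show ?thesis by (simp only: sum_distrib_left)
        qed
        also have "2 * (Suc n * ?\<Phi> e) = (\<Sum>x\<in>X. \<Sum>b\<in>(UNIV :: bool set). ?\<Phi> e)"
          using n(1) by (simp add: card_UNIV_bool)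
        also have "\<dots> \<le> (\<Sum>x\<in>X. \<Sum>b\<in>UNIV. card (exact_samples (X - {x}) (slice C x b) e))"
        proof (intro sum_mono)
          fix x b assume "x \<in> X"
          with IH[of x e b] large[of x b] n(2)
          show "?\<Phi> e \<le> card (exact_samples (X - {x}) (slice C x b) e)" by simp
        qed
        also have "\<dots> \<le> Suc e * card (exact_samples X C (Suc e))"
          by (rule sum_card_exact_samples[OF less.prems(1)])
        finally have "(\<Sum>i\<le>Suc e. Suc n choose i) \<le> card (exact_samples X C (Suc e))"
          by (simp only: mult_le_cancel1)
        with Suc n(1) show ?thesis by (simp only: min.coboundedI2)
      qed
    qed
  qed
qed

section \<open>Bounds above and below \<open>GMN'\<close>\<close>

context finite_class
begin

lemma separated: "separated X C"
  unfolding separated_def using concept_eqI by blast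

text \<open>For \<open>d = card X\<close> the sum is \<open>2 ^ card X\<close>, which bounds
  \<open>card C\<close>, and the sums increase with \<open>d\<close>; hence the least
  \<open>d\<close> acts as a threshold.\<close>

lemma GMN'_le_iff: "GMN' X C \<le> d \<longleftrightarrow> card C \<le> (\<Sum>i\<le>d. card X choose i)"
proof
  assume "card C \<le> (\<Sum>i\<le>d. card X choose i)"
  then show "GMN' X C \<le> d" unfolding GMN'_def by (rule Least_le)
next
  have "card C \<le> card (X \<rightarrow>\<^sub>E (UNIV :: bool set))"
    using concept_class by (intro card_mono) (auto simp: concept_class_def intro: finite_PiE)
  then have "card C \<le> (\<Sum>i\<le>card X. card X choose i)"
    by (simp add: card_PiE choose_row_sum)
  then have "card C \<le> (\<Sum>i\<le>GMN' X C. card X choose i)"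
    unfolding GMN'_def by (rule LeastI)
  moreover assume "GMN' X C \<le> d"
  then have "(\<Sum>i\<le>GMN' X C. card X choose i) \<le> (\<Sum>i\<le>d. card X choose i)"
    by (intro sum_mono2) auto
  ultimately show "card C \<le> (\<Sum>i\<le>d. card X choose i)" by simp
qed

text \<open>A larger sample at \<open>c\<close> would force the other concepts to use all
  restrictions of \<open>c\<close> to at most \<open>GMN' X C\<close> points: at least
  \<open>card C\<close> samples for \<open>card C - 1\<close> concepts.\<close>

lemma GMN_le_GMN': "GMN X C \<le> GMN' X C"
proof (rule GMN_le, rule ccontr)
  fix M c assume M: "greedy_matching X C M" and c: "c \<in> C" and *: "\<not> card (M c) \<le> GMN' X C"
  have "sample_of c ` subsets_upto X (GMN' X C) \<subseteq> M ` (C - {c})"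
  proof (rule image_subsetI)
    fix A assume "A \<in> subsets_upto X (GMN' X C)"
    then have "A \<subseteq> X" "card A < card (M c)" using * by (auto simp: subsets_upto_def)
    from greedy_subsample_used[OF M c this] obtain c' where "c' \<in> C - {c}" "M c' = sample_of c A" ..
    then show "sample_of c A \<in> M ` (C - {c})" by (metis imageI)
  qed
  then have "card (sample_of c ` subsets_upto X (GMN' X C)) \<le> card (C - {c})"
    by (intro surj_card_le) auto
  moreover have "inj_on (sample_of c) (subsets_upto X (GMN' X C))"
    by (auto simp: inj_on_def sample_of_eq_iff)
  ultimately have "(\<Sum>i\<le>GMN' X C. card X choose i) \<le> card (C - {c})"
    by (simp add: card_image card_subsets_upto)
  also have "\<dots> < card C" using c by (intro psubset_card_mono) auto
  finally have "\<not> GMN' X C \<le> GMN' X C" unfolding GMN'_le_iff by simp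
  then show False by simp
qed

lemma GMN'_le_VCD: "GMN' X C \<le> VCD X C"
proof -
  have "card C \<le> card {A. A \<subseteq> X \<and> shattered C A}"
    by (rule card_le_shattered[OF finite_dom finite_concepts separated])
  also have "\<dots> \<le> card (subsets_upto X (VCD X C))"
    by (intro card_mono finite_subsets_upto) (auto simp: subsets_upto_def card_le_VCD)
  finally show ?thesis by (simp add: card_subsets_upto GMN'_le_iff)
qed

text \<open>The indicator of a teaching set of size at most \<open>d\<close> has degree at most \<open>d\<close>; going through
  the concepts in a teaching order, these indicators form a triangular system.\<close>

lemma GMN'_le_RTD: "GMN' X C \<le> RTD X C"
proof -
  let ?d = "RTD X C"
  have span: "\<exists>F\<subseteq>subsets_upto X ?d. \<forall>c\<in>C'. parity F c = g c" if "C' \<subseteq> C" for C' g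
    using finite_subset[OF that finite_concepts] that
  proof (induction C' rule: finite_psubset_induct)
    case (psubset C')
    show ?case
    proof (cases "C' = {}")
      case False
      obtain c A where c: "c \<in> C'" "A \<subseteq> X" "card A \<le> ?d"
        "\<And>c'. \<lbrakk>c' \<in> C'; \<And>x. x \<in> A \<Longrightarrow> c' x = c x\<rbrakk> \<Longrightarrow> c' = c"
        by (rule RTD_teaches[OF psubset.prems False]) blast
      have finA: "finite A" using c(2) finite_subset by blast
      have "C' - {c} \<subset> C'" "C' - {c} \<subseteq> C" using c(1) psubset.prems by auto
      from psubset.IH[OF this] obtain F
        where F: "F \<subseteq> subsets_upto X ?d" "\<forall>c'\<in>C' - {c}. parity F c' = g c'"
        by (elim exE conjE) (rule that)
      show ?thesis
      proof (cases "parity F c = g c")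
        case True
        with F show ?thesis by blast
      next
        case False
        \<comment> \<open>The expanded indicator of agreement with \<open>c\<close> on
          \<open>A\<close>: adding it flips the value at \<open>c\<close> and at no other concept of
          \<open>C'\<close>.\<close>
        let ?G = "{B. {x \<in> A. c x} \<subseteq> B \<and> B \<subseteq> A}"
        have G: "parity ?G c' \<longleftrightarrow> c' = c" if "c' \<in> C'" for c'
          using parity_interval[OF finA, of "{x \<in> A. c x}" c'] c(4)[OF that] by auto
        have Gsub: "?G \<subseteq> subsets_upto X ?d"
        proof
          fix B assume "B \<in> ?G"
          then have "B \<subseteq> A" by simp
          then show "B \<in> subsets_upto X ?d"
            using c(2,3) card_mono[OF finA, of B] by (auto simp: subsets_upto_def)
        qed
        have "finite F" "finite ?G"
          using F(1) Gsub finite_subsets_upto[OF finite_dom] finite_subset by blast+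
        then have "parity ((F - ?G) \<union> (?G - F)) c' = g c'" if "c' \<in> C'" for c'
          using F(2) G[OF that] False that by (cases "c' = c") (auto simp: parity_sym_diff)
        moreover have "(F - ?G) \<union> (?G - F) \<subseteq> subsets_upto X ?d" using F(1) Gsub by auto
        ultimately show ?thesis by blast
      qed
    qed auto
  qed
  have "card C \<le> card (subsets_upto X ?d)"
    by (rule card_le_if_parities_span[OF finite_concepts finite_subsets_upto[OF finite_dom] span])
      simp
  then show ?thesis by (simp add: card_subsets_upto GMN'_le_iff)
qed

lemma AMN'_le_GMN': "AMN' X C \<le> GMN' X C"
proof -
  let ?d = "GMN' X C"
  have "card C \<le> card (X \<rightarrow>\<^sub>E (UNIV :: bool set))"
    using concept_class by (intro card_mono) (auto simp: concept_class_def intro: finite_PiE)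
  then have "?d \<le> card X"
    by (simp add: card_PiE choose_row_sum GMN'_le_iff)
  then have "min (card C) (\<Sum>i\<le>?d. card X choose i) \<le> card (exact_samples X C ?d)"
    by (rule card_exact_samples_ge[OF finite_dom finite_concepts separated])
  moreover have "card C \<le> (\<Sum>i\<le>?d. card X choose i)" using GMN'_le_iff by blast
  ultimately have "card C \<le> card (exact_samples X C ?d)" by simp
  then obtain A where A: "A \<subseteq> exact_samples X C ?d" "card A = card C"
    by (meson obtain_subset_with_card_n)
  have "S = T" if "S \<in> A" "T \<in> A" "S \<subseteq> T" for S T
  proof (rule card_subset_eq)
    have ST: "S \<in> exact_samples X C ?d" "T \<in> exact_samples X C ?d" using A(1) that by auto
    then show "finite T" using finite_subset[OF _ finite_dom] by (auto simp: exact_samples_def)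
    show "card S = card T" using ST[THEN card_exact_sample] by simp
  qed (rule that)
  then have "pairwise (\<lambda>S T. \<not> S \<subseteq> T) A" by (auto simp: pairwise_def)
  moreover have "A \<subseteq> realizable_samples X C ?d"
  proof
    fix S assume "S \<in> A"
    with A(1) obtain c B where "c \<in> C" "B \<subseteq> X" "card B = ?d" "S = sample_of c B"
      unfolding exact_samples_def by blast
    then show "S \<in> realizable_samples X C ?d" by (auto simp: realizable_samples_eq)
  qed
  ultimately show ?thesis using A(2) by (intro AMN'_le)
qed

end

section \<open>Separating classes\<close>

definition ind :: "'a set \<Rightarrow> 'a set \<Rightarrow> 'a concept" where
  "ind X B = (\<lambda>x\<in>X. x \<in> B)"

lemma ind_apply [simp]: "x \<in> X \<Longrightarrow> ind X B x \<longleftrightarrow> x \<in> B"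
  by (simp add: ind_def)

lemma inj_on_ind: "inj_on (ind X) (Pow X)"
proof (rule inj_onI)
  fix A B assume "A \<in> Pow X" "B \<in> Pow X" "ind X A = ind X B"
  moreover from this have "x \<in> A \<longleftrightarrow> x \<in> B" if "x \<in> X" for x
    using ind_apply[OF that, of A] ind_apply[OF that, of B] by simp
  ultimately show "A = B" by blast
qed

lemma finite_class_ind: "\<lbrakk>finite X; \<B> \<noteq> {}\<rbrakk> \<Longrightarrow> finite_class X (ind X ` \<B>)"
  by unfold_locales (auto simp: concept_class_def ind_def)

lemma card_ind: "\<B> \<subseteq> Pow X \<Longrightarrow> card (ind X ` \<B>) = card \<B>"
  by (rule card_image[OF inj_on_subset[OF inj_on_ind]])

lemma cube_flip:
  assumes "Y \<subseteq> X" "c \<in> ind X ` Pow Y" "y \<in> Y"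
  obtains c' where "c' \<in> ind X ` Pow Y" "c' y \<noteq> c y" "\<And>x. \<lbrakk>x \<in> X; x \<noteq> y\<rbrakk> \<Longrightarrow> c' x = c x"
proof -
  obtain B where B: "B \<subseteq> Y" "c = ind X B" using assms(2) by auto
  have y: "y \<in> X" using assms by blast
  show ?thesis
  proof (cases "y \<in> B")
    case True
    show ?thesis by (rule that[of "ind X (B - {y})"]) (use True B y in auto)
  next
    case False
    show ?thesis by (rule that[of "ind X (insert y B)"]) (use False B y assms(3) in auto)
  qed
qed

lemma finite_set_of_card:
  obtains X :: "'a :: infinite set" where "finite X" "card X = n"
  using infinite_arbitrarily_large[OF infinite_UNIV, of n] by blast

lemma small_set: "\<lbrakk>finite S; card S \<le> 1\<rbrakk> \<Longrightarrow> S = {} \<or> (\<exists>p. S = {p})"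
  by (cases "card S = 0") (auto simp: card_1_singleton_iff le_Suc_eq)

text \<open>Off \<open>Y\<close> only the label \<open>False\<close> occurs, which leaves
  \<open>card X + card Y\<close> singletons.\<close>

lemma small_sample_of_cube:
  assumes "finite X" "c \<in> ind X ` Pow Y" "S \<subseteq> sample_of c X" "card S \<le> 1"
  shows "S \<in> insert {} ((\<lambda>p. {p}) ` (X \<times> {False} \<union> Y \<times> {True}))"
proof -
  have "finite S" using assms(1,3) finite_subset by fastforce
  with assms(4) consider "S = {}" | p where "S = {p}" using small_set by blast
  then show ?thesis
  proof cases
    case 2
    with assms(3) obtain x where "x \<in> X" "p = (x, c x)" by (cases p) auto
    with assms(2) have "p \<in> X \<times> {False} \<union> Y \<times> {True}" by (cases "c x") auto
    with 2 show ?thesis by blast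
  qed simp
qed

lemma card_cube_cells:
  "\<lbrakk>finite X; finite Y\<rbrakk> \<Longrightarrow> card (X \<times> {False} \<union> Y \<times> {True}) = card X + card Y"
  by (subst card_Un_disjoint) (auto simp: card_cartesian_product)

text \<open>The square has as many labeled points as concepts, which suffices for an antichain of
  singletons. A greedy matching can be stuck at a poor choice, and no teaching sequence can make a
  first reduction, as every concept has a neighbor that differs at just one given point.\<close>

lemma square_witness:
  obtains X :: "'a :: infinite set" and C
  where "finite_class X C" "AMN X C \<le> 1" "2 \<le> GMN X C" "2 \<le> STD_min X C"
proof -
  obtain X :: "'a set" where X: "finite X" "card X = 2" by (rule finite_set_of_card)
  then obtain a b where ab: "X = {a, b}" "a \<noteq> b" by (auto simp: card_2_iff)
  define C where "C = ind X ` Pow X"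
  interpret finite_class X C
    unfolding C_def using X by (intro finite_class_ind) auto
  have "AMN X C \<le> 1"
  proof (rule AMN_le)
    let ?M = "\<lambda>c :: 'a concept. if c a = c b then {(a, c a)} else {(b, c b)}"
    have eq: "c = c'" if "c \<in> C" "c' \<in> C" "?M c \<subseteq> ?M c'" for c c'
      using that ab by (intro concept_eqI) (auto split: if_splits)
    have "?M c \<subseteq> full c" for c using ab by auto
    moreover have "inj_on ?M C"
    proof (rule inj_onI)
      fix c c' assume "c \<in> C" "c' \<in> C" "?M c = ?M c'"
      then show "c = c'" by (intro eq) simp_all
    qed
    ultimately show "saturating_matching X C ?M"
      unfolding saturating_matching_iff[OF finite_dom] by blast
    show "antichain_property C ?M"
      unfolding antichain_property_def using eq by blast
  qed auto
  moreover have "2 \<le> GMN X C"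
  proof -
    \<comment> \<open>Matching \<open>c\<close> with its negative labels is greedy: a smaller sample
      of \<open>c\<close> is empty or consists of labels \<open>False\<close>, and so belongs to the
      concept that is \<open>False\<close> exactly there.\<close>
    define zeros :: "'a concept \<Rightarrow> 'a set" where "zeros c = {x \<in> X. \<not> c x}" for c
    let ?M = "\<lambda>c. sample_of c (zeros c)"
    have zeros_X: "zeros c \<subseteq> X" for c by (auto simp: zeros_def)
    have card_zeros: "card (zeros c) \<le> 2" for c
      using card_mono[OF X(1) zeros_X, of c] X(2) by simp
    have zeros_inj: "c = c'" if "c \<in> C" "c' \<in> C" "zeros c = zeros c'" for c c'
      using that by (intro concept_eqI) (auto simp: zeros_def)
    have sat: "saturating_matching X C ?M"
      using zeros_X zeros_inj
      by (auto simp: saturating_matching_iff inj_on_def sample_of_eq_iff)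
    have "\<not> direct_improvement X C M' ?M" for M'
    proof
      assume "direct_improvement X C M' ?M"
      then obtain c where M': "saturating_matching X C M'" and c: "c \<in> C"
        "\<forall>c'\<in>C. c' \<noteq> c \<longrightarrow> M' c' = ?M c'" "card (M' c) < card (?M c)"
        unfolding direct_improvement_def by auto
      have "M' c \<subseteq> full c" using M' c(1) by (simp add: saturating_matching_iff)
      then obtain A where A: "A \<subseteq> X" "M' c = sample_of c A" by (rule subset_sample_ofE)
      have less: "card A < card (zeros c)" using c(3) A(2) by simp
      have "A \<subseteq> zeros c"
      proof (cases "A = {}")
        case False
        then have "0 < card A" using A(1) X(1) finite_subset card_gt_0_iff by metis
        with less card_zeros[of c] X(2) have "card X \<le> card (zeros c)" by simp
        then have "zeros c = X" using card_seteq[OF X(1) zeros_X] by blast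
        with A(1) show ?thesis by simp
      qed simp
      let ?c' = "ind X (X - A)"
      have c': "?c' \<in> C" by (auto simp: C_def)
      have zc': "zeros ?c' = A" using A(1) by (auto simp: zeros_def)
      then have "?c' \<noteq> c" using less by auto
      moreover have "?M ?c' = sample_of c A"
        using A(1) \<open>A \<subseteq> zeros c\<close> unfolding zc' sample_of_eq_iff by (auto simp: zeros_def)
      ultimately have "M' ?c' = M' c" using c(2) c' A(2) by simp
      then have "?c' = c"
        using M' c' c(1) by (auto simp: saturating_matching_def dest: inj_onD)
      with \<open>?c' \<noteq> c\<close> show False by contradiction
    qed
    with sat have greedy: "greedy_matching X C ?M" by (auto simp: greedy_matching_def)
    have "ind X {} \<in> C" by (auto simp: C_def)
    moreover have "zeros (ind X {}) = X" by (auto simp: zeros_def)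
    ultimately show ?thesis using GMN_ge[OF greedy, of "ind X {}"] X(2) by simp
  qed
  moreover have "2 \<le> STD_min X C"
  proof -
    obtain \<M> where seq: "subset_teaching_sequence X C \<M>"
      and cost: "sequence_cost C \<M> = STD_min X C"
      by (rule STD_min_attained)
    have full: "\<M> k c = full c" if "c \<in> C" for k c
      using that
    proof (induction k arbitrary: c)
      case 0
      with seq show ?case by (simp add: subset_teaching_sequence_def sample_of_def)
    next
      case (Suc k)
      have "\<M> (Suc k) c \<subseteq> \<M> k c"
        using seq Suc.prems by (simp add: subset_teaching_sequence_def)
      then have "\<M> (Suc k) c \<subseteq> full c" using Suc by simp
      then obtain A where A: "A \<subseteq> X" "\<M> (Suc k) c = sample_of c A" by (rule subset_sample_ofE)
      have "X \<subseteq> A"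
      proof
        fix x assume x: "x \<in> X"
        obtain c' where c': "c' \<in> ind X ` Pow X" "c' x \<noteq> c x"
          "\<And>y. \<lbrakk>y \<in> X; y \<noteq> x\<rbrakk> \<Longrightarrow> c' y = c y"
          by (rule cube_flip[OF order_refl _ x]) (use Suc.prems in \<open>auto simp: C_def\<close>)
        then have "c' \<in> C" "c \<noteq> c'" by (auto simp: C_def)
        then have "\<not> \<M> (Suc k) c \<subseteq> full c'"
          using seq Suc unfolding subset_teaching_sequence_def by metis
        with A c'(3) show "x \<in> A" by (auto simp: subset_iff)
      qed
      with A show ?case by auto
    qed
    have c: "ind X {} \<in> C" by (auto simp: C_def)
    show ?thesis
      using card_le_cost[OF c, of "\<M> (stabilization_index C \<M>)"] full[OF c] cost X(2)
      by (simp add: sequence_cost_def)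
  qed
  ultimately show ?thesis using finite_class_axioms that by blast
qed

lemma padded_square_witness:
  obtains X :: "'a :: infinite set" and C
  where "finite_class X C" "GMN' X C \<le> 1" "STD_min X C \<le> 1" "2 \<le> min_VCD_RTD X C"
proof -
  obtain X :: "'a set" where X: "finite X" "card X = 3" by (rule finite_set_of_card)
  then obtain a b z where abz: "X = {a, b, z}" "a \<noteq> b" "a \<noteq> z" "b \<noteq> z"
    by (auto simp: card_3_iff)
  define Y where "Y = {a, b}"
  have Y: "Y \<subseteq> X" "card Y = 2" "finite Y" using abz by (auto simp: Y_def)
  define C where "C = ind X ` Pow Y"
  interpret finite_class X C
    unfolding C_def using X by (intro finite_class_ind) auto
  have "card C = 4"
    using Y unfolding C_def by (subst card_ind) (auto simp: card_Pow)
  then have "GMN' X C \<le> 1" by (simp add: GMN'_le_iff X(2))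
  moreover have "2 \<le> VCD X C"
  proof -
    have "shattered C Y"
      unfolding shattered_iff
    proof
      fix g :: "'a \<Rightarrow> bool"
      show "\<exists>c\<in>C. \<forall>x\<in>Y. c x = g x"
        by (rule bexI[of _ "ind X {y \<in> Y. g y}"]) (use Y(1) in \<open>auto simp: C_def\<close>)
    qed
    from card_le_VCD[OF Y(1) this] Y(2) show ?thesis by simp
  qed
  moreover have "2 \<le> RTD X C"
  proof (rule RTD_ge, rule ccontr)
    fix c assume c: "c \<in> C" and small: "\<not> 2 \<le> TD X c C"
    obtain A where A: "A \<subseteq> X" "\<And>c'. \<lbrakk>c' \<in> C; \<And>x. x \<in> A \<Longrightarrow> c' x = c x\<rbrakk> \<Longrightarrow> c' = c"
      "card A = TD X c C"
      by (rule TD_attained[OF order_refl c]) blast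
    have "\<not> Y \<subseteq> A"
      using card_mono[of A Y] finite_subset[OF A(1) X(1)] A(3) small Y(2) by auto
    then obtain y where y: "y \<in> Y" "y \<notin> A" by blast
    obtain c' where c': "c' \<in> ind X ` Pow Y" "c' y \<noteq> c y"
      "\<And>x. \<lbrakk>x \<in> X; x \<noteq> y\<rbrakk> \<Longrightarrow> c' x = c x"
      by (rule cube_flip[OF Y(1) _ y(1)]) (use c in \<open>auto simp: C_def\<close>)
    have "c' = c"
      by (rule A(2)) (use c' A(1) y(2) in \<open>auto simp: C_def\<close>)
    with c'(2) show False by simp
  qed
  moreover have "STD_min X C \<le> 1"
  proof -
    \<comment> \<open>All concepts but the all-zero one give up \<open>z\<close>, which frees
      \<open>{z}\<close> for that one. Its departure frees the label \<open>False\<close> at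
      \<open>b\<close> and at \<open>a\<close> for the two mixed concepts, and then the label
      \<open>True\<close> at \<open>a\<close> is left to the all-one labeling of the square.\<close>
    let ?M1 = "\<lambda>c. sample_of c (if c a \<or> c b then {a, b} else X)"
    let ?M2 = "\<lambda>c. sample_of c (if c a \<or> c b then {a, b} else {z})"
    let ?M3 = "\<lambda>c. sample_of c
      (if c a \<and> c b then {a, b} else if c a then {b} else if c b then {a} else {z})"
    let ?M4 = "\<lambda>c. sample_of c
      (if c a \<and> c b then {a} else if c a then {b} else if c b then {a} else {z})"
    have z: "\<not> c z" if "c \<in> C" for c using that abz by (auto simp: C_def Y_def)
    have diff: "c a \<noteq> c' a \<or> c b \<noteq> c' b" if "c \<in> C" "c' \<in> C" "c \<noteq> c'" for c c'
      using that concept_eqI[OF that(1,2)] z[OF that(1)] z[OF that(2)] abz(1) by auto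
    have "shrinks C full ?M1" "shrinks C ?M1 ?M2" "shrinks C ?M2 ?M3" "shrinks C ?M3 ?M4"
      unfolding shrinks_def
      by (intro ballI conjI impI; (drule (2) diff)?; use abz in \<open>auto split: if_splits\<close>)+
    then have reach: "(shrinks C)\<^sup>*\<^sup>* full ?M4"
      by (meson converse_rtranclp_into_rtranclp rtranclp.rtrancl_refl)
    show ?thesis by (rule STD_min_le[OF reach]) auto
  qed
  ultimately show ?thesis using finite_class_axioms that by (simp add: min_VCD_RTD_def)
qed

text \<open>The three-dimensional cube with an additional constant point has \<open>8\<close> concepts and
  \<open>8\<close> realizable samples of size at most \<open>1\<close>, one of which is empty.\<close>

lemma padded_cube_witness:
  obtains X :: "'a :: infinite set" and C
  where "finite_class X C" "SMN X C \<le> 1" "2 \<le> AMN' X C"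
proof -
  obtain X :: "'a set" where X: "finite X" "card X = 4" by (rule finite_set_of_card)
  then obtain Y where Y: "Y \<subseteq> X" "card Y = 3" using obtain_subset_with_card_n[of 3 X] by auto
  obtain p q r where pqr: "Y = {p, q, r}" "p \<noteq> q" "p \<noteq> r" "q \<noteq> r"
    using Y(2) by (auto simp: card_3_iff)
  have "card (X - Y) = 1" using X Y by (simp add: card_Diff_subset finite_subset)
  then obtain z where "X - Y = {z}" by (auto simp: card_1_singleton_iff)
  then have Xz: "X = {p, q, r, z}" "z \<notin> {p, q, r}" using Y(1) pqr(1) by auto
  define C where "C = ind X ` Pow Y"
  interpret finite_class X C
    unfolding C_def using X by (intro finite_class_ind) auto
  have cardC: "card C = 8"
    unfolding C_def using Y X finite_subset[OF Y(1)] by (subst card_ind) (auto simp: card_Pow)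
  have z: "\<not> c z" if "c \<in> C" for c using that Xz pqr by (auto simp: C_def)
  have "SMN X C \<le> 1"
  proof (rule SMN_le)
    \<comment> \<open>A nonconstant labeling of three points has one point in the minority, which
      gives six singletons. The two constant labelings take the empty sample and the point
      \<open>z\<close>.\<close>
    let ?M = "\<lambda>c :: 'a concept.
      if c p = c q \<and> c q = c r then (if c p then {(z, False)} else {})
      else if c q = c r then {(p, c p)} else if c p = c r then {(q, c q)} else {(r, c r)}"
    have "?M c \<subseteq> full c" if "c \<in> C" for c using z[OF that] Xz(1) by auto
    moreover have "inj_on ?M C"
    proof (rule inj_onI)
      fix c c' assume c: "c \<in> C" "c' \<in> C" "?M c = ?M c'"
      have "c p = c' p \<and> c q = c' q \<and> c r = c' r"
        using c(3) pqr Xz(2) by (auto split: if_splits)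
      with c(1,2) z show "c = c'" by (intro concept_eqI) (auto simp: Xz(1))
    qed
    ultimately show "saturating_matching X C ?M"
      unfolding saturating_matching_iff[OF finite_dom] by blast
  qed auto
  moreover have "2 \<le> AMN' X C"
  proof (rule ccontr)
    assume small: "\<not> 2 \<le> AMN' X C"
    obtain \<A> where A: "\<A> \<subseteq> realizable_samples X C (AMN' X C)"
      "pairwise (\<lambda>S T. \<not> S \<subseteq> T) \<A>" "card \<A> = card C"
      by (rule AMN'_attained)
    let ?P = "(\<lambda>p. {p}) ` (X \<times> {False} \<union> Y \<times> {True})"
    have sub: "\<A> \<subseteq> insert {} ?P"
    proof
      fix S assume "S \<in> \<A>"
      with A(1) small obtain c where "c \<in> C" "S \<subseteq> full c" "card S \<le> 1"
        by (auto simp: realizable_samples_eq)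
      then show "S \<in> insert {} ?P"
        unfolding C_def by (intro small_sample_of_cube[OF finite_dom])
    qed
    have finY: "finite Y" using Y(1) X(1) finite_subset by blast
    show False
    proof (cases "{} \<in> \<A>")
      case True
      with A(2) have "\<A> = {{}}" by (auto simp: pairwise_def)
      with A(3) cardC show False by simp
    next
      case False
      with sub have "\<A> \<subseteq> ?P" by auto
      then have "card \<A> \<le> card (X \<times> {False} \<union> Y \<times> {True})"
        using X(1) finY by (intro surj_card_le) auto
      with A(3) cardC card_cube_cells[OF X(1) finY] X(2) Y(2) show False by simp
    qed
  qed
  ultimately show ?thesis using finite_class_axioms that by blast
qed

text \<open>Sixteen concepts of a four-dimensional cube compete for only fourteen samples, although the
  additional all-ones concept makes many more samples realizable.\<close>

lemma cube_and_antipode_witness: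
  obtains X :: "'a :: infinite set" and C
  where "finite_class X C" "AMN' X C \<le> 1" "2 \<le> SMN X C"
proof -
  \<comment> \<open>Nine points make \<open>2 * 9 = 18\<close> singletons for
    \<open>2 ^ 4 + 1 = 17\<close> concepts, whereas the cube on four of them has only
    \<open>9 + 4 + 1 = 14\<close> samples of size at most one.\<close>
  obtain X :: "'a set" where X: "finite X" "card X = 9" by (rule finite_set_of_card)
  then obtain Y where Y: "Y \<subseteq> X" "card Y = 4" using obtain_subset_with_card_n[of 4 X] by auto
  have finY: "finite Y" using Y(1) X(1) finite_subset by blast
  define C where "C = ind X ` insert X (Pow Y)"
  interpret finite_class X C
    unfolding C_def using X by (intro finite_class_ind) auto
  have "X \<notin> Pow Y" using X Y card_mono[OF finY, of X] by auto
  then have cardC: "card C = 17"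
    unfolding C_def using Y finY by (subst card_ind) (auto simp: card_Pow)
  have "AMN' X C \<le> 1"
  proof -
    have "card ((\<lambda>p. {p}) ` (X \<times> (UNIV :: bool set))) = 18"
      using X by (simp add: card_image inj_on_def card_cartesian_product)
    then obtain \<A> where A: "\<A> \<subseteq> (\<lambda>p. {p}) ` (X \<times> (UNIV :: bool set))" "card \<A> = card C"
      using obtain_subset_with_card_n[of 17 "(\<lambda>p. {p}) ` (X \<times> (UNIV :: bool set))"] cardC by auto
    have single: "{(x, v)} \<in> realizable_samples X C 1" if "x \<in> X" for x v
    proof -
      have "ind X (if v then X else {}) \<in> C" by (auto simp: C_def)
      moreover have "{(x, v)} \<subseteq> full (ind X (if v then X else {}))" using that by auto
      ultimately show ?thesis unfolding realizable_samples_eq[OF finite_dom] by auto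
    qed
    have "\<A> \<subseteq> realizable_samples X C 1"
    proof
      fix S assume "S \<in> \<A>"
      with A(1) obtain x v where "x \<in> X" "S = {(x, v)}" by blast
      with single show "S \<in> realizable_samples X C 1" by simp
    qed
    moreover have "pairwise (\<lambda>S T. \<not> S \<subseteq> T) \<A>"
    proof (rule pairwiseI)
      fix S T assume ST: "S \<in> \<A>" "T \<in> \<A>" "S \<noteq> T"
      obtain p where "S = {p}" using subsetD[OF A(1) ST(1)] by blast
      moreover obtain q where "T = {q}" using subsetD[OF A(1) ST(2)] by blast
      ultimately show "\<not> S \<subseteq> T" using ST(3) by simp
    qed
    ultimately show ?thesis using A(2) by (intro AMN'_le)
  qed
  moreover have "2 \<le> SMN X C"
  proof (rule ccontr)
    assume small: "\<not> 2 \<le> SMN X C"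
    obtain M where M: "saturating_matching X C M" "\<And>c. c \<in> C \<Longrightarrow> card (M c) \<le> SMN X C"
      by (rule SMN_attained) blast
    let ?P = "(\<lambda>p. {p}) ` (X \<times> {False} \<union> Y \<times> {True})"
    let ?D = "ind X ` Pow Y"
    have DC: "?D \<subseteq> C" by (auto simp: C_def)
    have "M ` ?D \<subseteq> insert {} ?P"
    proof (rule image_subsetI)
      fix c assume c: "c \<in> ?D"
      with DC have cC: "c \<in> C" by blast
      have "M c \<subseteq> full c" using M(1) cC by (simp add: saturating_matching_iff)
      moreover have "card (M c) \<le> 1" using M(2)[OF cC] small by simp
      ultimately show "M c \<in> insert {} ?P" using c by (intro small_sample_of_cube[OF finite_dom])
    qed
    moreover have "inj_on M ?D"
      using M(1) DC by (auto simp: saturating_matching_def intro: inj_on_subset)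
    ultimately have "card ?D \<le> card (insert {} ?P)"
      using X(1) finY by (intro card_inj_on_le[of M]) auto
    also have "\<dots> \<le> Suc (card ?P)" by (rule card_insert_le_m1) auto
    also have "card ?P \<le> 13"
      using card_image_le[of "X \<times> {False} \<union> Y \<times> {True}" "\<lambda>p. {p}"]
        card_cube_cells[OF X(1) finY] X Y(2) finY by simp
    finally have "card ?D \<le> 14" by simp
    moreover have "card ?D = 16"
      using Y finY by (subst card_ind) (auto simp: card_Pow)
    ultimately show False by simp
  qed
  ultimately show ?thesis using finite_class_axioms that by blast
qed

text \<open>Two copies of the square on \<open>Y\<close>, complementary on \<open>Z\<close>. In a greedy matching of cost \<open>2\<close>
  the remaining seven concepts use up the seven subsamples of size at most \<open>1\<close> of some concept
  \<open>c\<close>, but only three of them are consistent with one of the four concepts of the other square.\<close>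

lemma twin_squares_witness:
  obtains X :: "'a :: infinite set" and C
  where "finite_class X C" "GMN X C \<le> 1" "2 \<le> GMN' X C"
proof -
  \<comment> \<open>On six points a concept has \<open>1 + 6 = 7\<close> subsamples of size at most
    one, one fewer than the eight concepts: too few for \<open>GMN' \<le> 1\<close>, yet enough to
    occupy all the other concepts.\<close>
  obtain X :: "'a set" where X: "finite X" "card X = 6" by (rule finite_set_of_card)
  then obtain Y where Y: "Y \<subseteq> X" "card Y = 2" using obtain_subset_with_card_n[of 2 X] by auto
  have finY: "finite Y" using Y(1) X(1) finite_subset by blast
  define Z where "Z = X - Y"
  have "card Z = 4" using X Y finY by (simp add: Z_def card_Diff_subset)
  then obtain z where z: "z \<in> Z" by fastforce
  have XYZ: "X = Y \<union> Z" "Y \<inter> Z = {}" using Y(1) by (auto simp: Z_def)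
  define half where "half v = (if v then (\<union>) Z ` Pow Y else Pow Y)" for v
  have half_X: "half v \<subseteq> Pow X" for v using XYZ by (auto simp: half_def)
  have inj: "inj_on ((\<union>) Z) (Pow Y)" using XYZ(2) by (auto simp: inj_on_def)
  have card_half: "card (half v) = 4" for v
    using inj finY Y(2) by (auto simp: half_def card_image card_Pow)
  have fin_half: "finite (half v)" for v using finY by (simp add: half_def)
  have half_Z: "x \<in> B \<longleftrightarrow> v" if "B \<in> half v" "x \<in> Z" for B v x
    using that XYZ(2) by (auto simp: half_def split: if_splits)
  define C where "C = ind X ` (half True \<union> half False)"
  interpret finite_class X C
    unfolding C_def using X by (intro finite_class_ind) (auto simp: half_def)
  have "half True \<inter> half False = {}" using half_Z[OF _ z] by blast
  then have "card (half True \<union> half False) = 8"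
    using fin_half card_half by (simp add: card_Un_disjoint)
  then have cardC: "card C = 8"
    unfolding C_def using half_X by (subst card_ind) auto
  have "GMN X C \<le> 1"
  proof (rule GMN_le, rule ccontr)
    fix M c assume M: "greedy_matching X C M" and c: "c \<in> C" and big: "\<not> card (M c) \<le> 1"
    have sat: "saturating_matching X C M" using M by (simp add: greedy_matching_def)
    then have inj_M: "inj_on M C" by (simp add: saturating_matching_def)
    obtain B v where B: "B \<in> half v" "c = ind X B" using c by (auto simp: C_def)
    let ?S = "sample_of c ` subsets_upto X 1"
    let ?D = "ind X ` half (\<not> v)"
    have inj_S: "inj_on (sample_of c) U" for U by (auto simp: inj_on_def sample_of_eq_iff)
    have "?S \<subseteq> M ` (C - {c})"
    proof (rule image_subsetI)
      fix A assume "A \<in> subsets_upto X 1"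
      then have "A \<subseteq> X" "card A < card (M c)" using big by (auto simp: subsets_upto_def)
      from greedy_subsample_used[OF M c this] obtain c' where "c' \<in> C - {c}" "M c' = sample_of c A" ..
      then show "sample_of c A \<in> M ` (C - {c})" by (metis imageI)
    qed
    moreover have "card ?S = 7"
      using X by (simp add: card_image[OF inj_S] card_subsets_upto)
    moreover have "card (M ` (C - {c})) = 7"
      using cardC c inj_on_subset[OF inj_M, of "C - {c}"] by (simp add: card_image)
    ultimately have used: "M ` (C - {c}) = ?S"
      using card_subset_eq[of "M ` (C - {c})" ?S] by simp
    have D: "?D \<subseteq> C - {c}"
    proof
      fix c' assume "c' \<in> ?D"
      then obtain B' where B': "B' \<in> half (\<not> v)" "c' = ind X B'" by blast
      have "c' z \<noteq> c z" using half_Z[OF B(1) z] half_Z[OF B'(1) z] B(2) B'(2) z XYZ(1) by simp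
      moreover have "c' \<in> C" using B' by (cases v) (auto simp: C_def)
      ultimately show "c' \<in> C - {c}" by auto
    qed
    have "M ` ?D \<subseteq> sample_of c ` subsets_upto Y 1"
    proof (rule image_subsetI)
      fix c' assume c': "c' \<in> ?D"
      then obtain B' where B': "B' \<in> half (\<not> v)" "c' = ind X B'" by blast
      have "M c' \<in> ?S" using used c' D by blast
      then obtain A where A: "A \<in> subsets_upto X 1" "M c' = sample_of c A" by blast
      have "M c' \<subseteq> full c'" using sat c' D by (auto simp: saturating_matching_iff)
      then have agree: "c x = c' x" if "x \<in> A" for x using that unfolding A(2) by simp
      have "x \<notin> Z" if "x \<in> A" for x
        using agree[OF that] half_Z[OF B(1)] half_Z[OF B'(1)] B(2) B'(2) XYZ(1) by auto
      then have "A \<in> subsets_upto Y 1" using A(1) XYZ(1) by (auto simp: subsets_upto_def)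
      with A(2) show "M c' \<in> sample_of c ` subsets_upto Y 1" by simp
    qed
    moreover have "inj_on M ?D" using inj_on_subset[OF inj_M] D by blast
    ultimately have "card ?D \<le> card (sample_of c ` subsets_upto Y 1)"
      using finite_subsets_upto[OF finY] by (intro card_inj_on_le[of M]) auto
    also have "\<dots> = 3" by (simp add: card_image[OF inj_S] card_subsets_upto[OF finY] Y(2))
    finally have "card ?D \<le> 3" .
    moreover have "card ?D = 4" using half_X card_half by (subst card_ind) auto
    ultimately show False by simp
  qed
  moreover have "\<not> GMN' X C \<le> 1" using cardC X(2) by (simp add: GMN'_le_iff)
  ultimately show ?thesis using finite_class_axioms that[of X C] by simp
qed

section \<open>Assembly of the ten relations\<close>

lemma parameter_arrowI:
  assumes "\<And>X C. finite_class X C \<Longrightarrow> Y X C \<le> Z X C"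
    and "finite_class X C" "Y X C \<le> 1" "2 \<le> Z X C"
  shows "Y \<longmapsto> Z"
  unfolding parameter_arrow_def
proof (intro conjI allI impI exI)
  show "concept_class X C" using assms(2) by (rule finite_class.concept_class)
  show "Y X C < Z X C" using assms(3,4) by simp
qed (rule assms(1), rule finite_class.intro)

theorem mainTheorem1:
  shows "(SMN' :: ('a :: infinite) parameter) \<longmapsto> SMN
    \<and> (SMN :: 'a parameter) \<longmapsto> GMN
    \<and> (GMN :: 'a parameter) \<longmapsto> GMN'
    \<and> (GMN' :: 'a parameter) \<longmapsto> min_VCD_RTD
    \<and> (SMN' :: 'a parameter) \<longmapsto> AMN'
    \<and> (AMN' :: 'a parameter) \<longmapsto> AMN
    \<and> (AMN :: 'a parameter) \<longmapsto> STD_min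
    \<and> (STD_min :: 'a parameter) \<longmapsto> min_VCD_RTD
    \<and> (SMN :: 'a parameter) \<longmapsto> AMN
    \<and> (AMN' :: 'a parameter) \<longmapsto> GMN'"
proof (intro conjI)
  note inequalities = finite_class.SMN'_le_SMN finite_class.SMN_le_GMN finite_class.GMN_le_GMN'
    finite_class.SMN'_le_AMN' finite_class.AMN'_le_AMN finite_class.AMN_le_STD_min
    finite_class.SMN_le_AMN finite_class.AMN'_le_GMN'
  obtain X :: "'a set" and C where sq: "finite_class X C" "AMN X C \<le> 1" "2 \<le> GMN X C"
    "2 \<le> STD_min X C"
    by (rule square_witness)
  note sq_ineqs = inequalities[OF sq(1)]
  show "(SMN :: 'a parameter) \<longmapsto> GMN"
    by (rule parameter_arrowI[OF finite_class.SMN_le_GMN sq(1)]) (use sq sq_ineqs in linarith)+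
  show "(AMN :: 'a parameter) \<longmapsto> STD_min"
    by (rule parameter_arrowI[OF finite_class.AMN_le_STD_min sq(1)]) (use sq sq_ineqs in linarith)+
  show "(AMN' :: 'a parameter) \<longmapsto> GMN'"
    by (rule parameter_arrowI[OF finite_class.AMN'_le_GMN' sq(1)]) (use sq sq_ineqs in linarith)+
  obtain X :: "'a set" and C where psq: "finite_class X C" "GMN' X C \<le> 1" "STD_min X C \<le> 1"
    "2 \<le> min_VCD_RTD X C"
    by (rule padded_square_witness)
  show "(GMN' :: 'a parameter) \<longmapsto> min_VCD_RTD"
    by (rule parameter_arrowI[OF _ psq(1)])
      (use psq in \<open>auto simp: min_VCD_RTD_def finite_class.GMN'_le_VCD finite_class.GMN'_le_RTD\<close>)
  show "(STD_min :: 'a parameter) \<longmapsto> min_VCD_RTD"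
    by (rule parameter_arrowI[OF _ psq(1)])
      (use psq in \<open>auto simp: min_VCD_RTD_def finite_class.STD_min_le_VCD
        finite_class.STD_min_le_RTD\<close>)
  obtain X :: "'a set" and C where cube: "finite_class X C" "SMN X C \<le> 1" "2 \<le> AMN' X C"
    by (rule padded_cube_witness)
  note cube_ineqs = inequalities[OF cube(1)]
  show "(SMN' :: 'a parameter) \<longmapsto> AMN'"
    by (rule parameter_arrowI[OF finite_class.SMN'_le_AMN' cube(1)])
      (use cube cube_ineqs in linarith)+
  show "(SMN :: 'a parameter) \<longmapsto> AMN"
    by (rule parameter_arrowI[OF finite_class.SMN_le_AMN cube(1)])
      (use cube cube_ineqs in linarith)+
  obtain X :: "'a set" and C where anti: "finite_class X C" "AMN' X C \<le> 1" "2 \<le> SMN X C"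
    by (rule cube_and_antipode_witness)
  note anti_ineqs = inequalities[OF anti(1)]
  show "(SMN' :: 'a parameter) \<longmapsto> SMN"
    by (rule parameter_arrowI[OF finite_class.SMN'_le_SMN anti(1)])
      (use anti anti_ineqs in linarith)+
  show "(AMN' :: 'a parameter) \<longmapsto> AMN"
    by (rule parameter_arrowI[OF finite_class.AMN'_le_AMN anti(1)])
      (use anti anti_ineqs in linarith)+
  obtain X :: "'a set" and C where twin: "finite_class X C" "GMN X C \<le> 1" "2 \<le> GMN' X C"
    by (rule twin_squares_witness)
  show "(GMN :: 'a parameter) \<longmapsto> GMN'"
    by (rule parameter_arrowI[OF finite_class.GMN_le_GMN' twin(1)]) (use twin in auto)
qed

end
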